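(* Let $0<q<1$, let $n\ge1$ and $r,s\ge0$ be integers and $m\ge1$ an integer. Then \[ \int_{0\le x_1\le\cdots\le x_n\le1}\prod_{i=1}^n x_i^r(qx_i;q)_s\prod_{1\le i<j\le n}x_j^{2m-1}(q^{1-m}x_i/x_j;q)_{2m-1}\,\overline{\Delta}(x)\,d_qx_1\cdots d_qx_n =q^{-\binom m2\binom n2}([r]_q!)^n([s]_q!)^n([m]_q!)^{2\binom n2}\int_{\mathcal O(P(n,r,s,m))}d_qW, \] where $x_j^{2m-1}(q^{1-m}x_i/x_j;q)_{2m-1}$ denotes the polynomial $\prod_{l=0}^{2m-2}(x_j-q^{1-m+l}x_i)$.
   Context: $\overline\Delta(x)=\prod_{1\le i<j\le n}(x_j-x_i)$; $(y;q)_k=\prod_{l=0}^{k-1}(1-yq^l)$; $[k]_q!=\prod_{j=1}^k\frac{1-q^j}{1-q}$. The Selberg poset $P(n,r,s,m)$ has elements $x_i,y_i^{(a)},z_i^{(b)},w_{i,j}^{(k)}$ for $i,j\in[n]$, $i\neq j$, $a\in[r]$, $b\in[s]$, $k\in[m]$, and its order is generated by the relations: $x_i<w_{i,j}^{(1)}<\cdots<w_{i,j}^{(m)}<x_j$ and $x_i<w_{j,i}^{(m)}<\cdots<w_{j,i}^{(1)}<x_j$ for $1\le i<j\le n$; and $y_i^{(1)}<\cdots<y_i^{(r)}<x_i<z_i^{(1)}<\cdots<z_i^{(s)}$ for $1\le i\le n$. $W$ is the word listing all elements: first the words $w_{i,j}^{(1)}\cdots w_{i,j}^{(m)}$ for $1\le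 i<j\le n$ in lexicographic order of $(i,j)$, then $w_{j,i}^{(1)}\cdots w_{j,i}^{(m)}$ for $1\le i<j\le n$ in lexicographic order of $(i,j)$, then $y_1^{(1)}\cdots y_1^{(r)}\,y_2^{(1)}\cdots y_n^{(r)}$, then $x_1\cdots x_n$, then $z_1^{(1)}\cdots z_1^{(s)}\cdots z_n^{(1)}\cdots z_n^{(s)}$. $\mathcal O(P)$ is the set of points of $[0,1]^{P}$ (coordinates indexed by elements of $P$) with $u\le v$ whenever $u\le_P v$. For $0<q<1$, $\int_a^b g\,dq u=(1-q)\sum_{i\ge0}(g(bq^i)bq^i-g(aq^i)aq^i)$; a multiple $q$-integral over a convex polytope with a given order of differentials is iterated with the first-written differential innermost, each variable running from the minimum to the maximum of its allowed values given the outer variables. $d_qW$ is the order of integration obtained by putting $d_q$ in front of each letter of $W$ (first letter innermost); on the left side the order is $d_qx_1\cdots d_qx_n$. *)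

theory Defs
  imports "HOL-Analysis.Analysis"
begin

definition q_pochhammer :: "real \<Rightarrow> real \<Rightarrow> nat \<Rightarrow> real" where
  "q_pochhammer y q k = (\<Prod>l<k. 1 - y * q ^ l)"

definition q_fact :: "real \<Rightarrow> nat \<Rightarrow> real" where
  "q_fact q k = (\<Prod>j=1..k. (1 - q ^ j) / (1 - q))"

definition index_pairs :: "nat \<Rightarrow> (nat \<times> nat) set" where
  "index_pairs n = {(i, j). 1 \<le> i \<and> i < j \<and> j \<le> n}"

definition Delta_bar :: "nat \<Rightarrow> (nat \<Rightarrow> real) \<Rightarrow> real" where
  "Delta_bar n x = (\<Prod>(i, j)\<in>index_pairs n. x j - x i)"

definition q_integral :: "real \<Rightarrow> real \<Rightarrow> real \<Rightarrow> (real \<Rightarrow> real) \<Rightarrow> real" where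
  "q_integral q a b g =
     (1 - q) * (\<Sum>i. g (b * q ^ i) * (b * q ^ i) - g (a * q ^ i) * (a * q ^ i))"

text \<open>
  Values of coordinate \<open>v\<close> at the points of \<open>D\<close> whose coordinates in the set \<open>F\<close> agree
  with those of \<open>u\<close>.
\<close>
definition allowed_values ::
    "('a \<Rightarrow> real) set \<Rightarrow> 'a set \<Rightarrow> ('a \<Rightarrow> real) \<Rightarrow> 'a \<Rightarrow> real set" where
  "allowed_values D F u v = {p v | p. p \<in> D \<and> (\<forall>w\<in>F. p w = u w)}"

text \<open>
  Iterated \<open>q\<close>-integral. The list of variables is consumed from the outermost to the
  innermost; \<open>F\<close> is the set of outer variables already fixed, with values given by \<open>u\<close>.
  For a polytope \<open>D\<close> the infimum and supremum below are a minimum and a maximum.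
  A \<open>q\<close>-integral from \<open>a > 0\<close> to \<open>b\<close> also samples its integrand at points \<open>a * q ^ i\<close>
  below \<open>a\<close>, for which an inner variable may have no allowed value; such an inner integral
  is an integral over the empty set and has the value 0.
\<close>
primrec iter_q_integral ::
    "real \<Rightarrow> ('a \<Rightarrow> real) set \<Rightarrow> (('a \<Rightarrow> real) \<Rightarrow> real) \<Rightarrow> 'a list \<Rightarrow>
     'a set \<Rightarrow> ('a \<Rightarrow> real) \<Rightarrow> real" where
  "iter_q_integral q D f [] F u = f u"
| "iter_q_integral q D f (v # vs) F u =
     (let A = allowed_values D F u v in
      if A = {} then 0
      else q_integral q (Inf A) (Sup A)
             (\<lambda>t. iter_q_integral q D f vs (insert v F) (u(v := t))))"

text \<open>
  \<open>multi_q_integral q D f [v1, ..., vN]\<close> is the integral of \<open>f\<close> over \<open>D\<close> with the differentials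
  written in the order \<open>v1, ..., vN\<close>, the first one being innermost.
\<close>
definition multi_q_integral ::
    "real \<Rightarrow> ('a \<Rightarrow> real) set \<Rightarrow> (('a \<Rightarrow> real) \<Rightarrow> real) \<Rightarrow> 'a list \<Rightarrow> real" where
  "multi_q_integral q D f vs = iter_q_integral q D f (rev vs) {} (\<lambda>_. undefined)"

text \<open>The points of the polytope are extensional functions on the carrier \<open>P\<close>.\<close>
definition order_polytope :: "'a set \<Rightarrow> ('a \<times> 'a) set \<Rightarrow> ('a \<Rightarrow> real) set" where
  "order_polytope P le =
     {u \<in> P \<rightarrow>\<^sub>E {0..1}. \<forall>a\<in>P. \<forall>b\<in>P. (a, b) \<in> le \<longrightarrow> u a \<le> u b}"

definition ordered_simplex :: "nat \<Rightarrow> (nat \<Rightarrow> real) set" where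
  "ordered_simplex n = {x \<in> {1..n} \<rightarrow>\<^sub>E {0..1}. mono_on {1..n} x}"

text \<open>\<open>X i\<close>, \<open>Y i a\<close>, \<open>Z i b\<close>, \<open>W i j k\<close> stand for $x_i$, $y_i^{(a)}$, $z_i^{(b)}$, $w_{i,j}^{(k)}$.\<close>
datatype selberg_elem = X nat | Y nat nat | Z nat nat | W nat nat nat

definition selberg_carrier :: "nat \<Rightarrow> nat \<Rightarrow> nat \<Rightarrow> nat \<Rightarrow> selberg_elem set" where
  "selberg_carrier n r s m =
     {X i | i. i \<in> {1..n}} \<union>
     {Y i a | i a. i \<in> {1..n} \<and> a \<in> {1..r}} \<union>
     {Z i b | i b. i \<in> {1..n} \<and> b \<in> {1..s}} \<union>
     {W i j k | i j k. i \<in> {1..n} \<and> j \<in> {1..n} \<and> i \<noteq> j \<and> k \<in> {1..m}}"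

definition selberg_chains :: "nat \<Rightarrow> nat \<Rightarrow> nat \<Rightarrow> nat \<Rightarrow> selberg_elem list set" where
  "selberg_chains n r s m =
     {[X i] @ map (W i j) [1..<Suc m] @ [X j] | i j. (i, j) \<in> index_pairs n} \<union>
     {[X i] @ map (W j i) (rev [1..<Suc m]) @ [X j] | i j. (i, j) \<in> index_pairs n} \<union>
     {map (Y i) [1..<Suc r] @ [X i] @ map (Z i) [1..<Suc s] | i. i \<in> {1..n}}"

text \<open>\<open>zip c (tl c)\<close> lists the pairs of consecutive elements of the chain \<open>c\<close>.\<close>
definition selberg_le :: "nat \<Rightarrow> nat \<Rightarrow> nat \<Rightarrow> nat \<Rightarrow> (selberg_elem \<times> selberg_elem) set" where
  "selberg_le n r s m = (\<Union>c\<in>selberg_chains n r s m. set (zip c (tl c)))\<^sup>*"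

definition selberg_word :: "nat \<Rightarrow> nat \<Rightarrow> nat \<Rightarrow> nat \<Rightarrow> selberg_elem list" where
  "selberg_word n r s m =
     [W i j k. i \<leftarrow> [1..<Suc n], j \<leftarrow> [Suc i..<Suc n], k \<leftarrow> [1..<Suc m]] @
     [W j i k. i \<leftarrow> [1..<Suc n], j \<leftarrow> [Suc i..<Suc n], k \<leftarrow> [1..<Suc m]] @
     [Y i a. i \<leftarrow> [1..<Suc n], a \<leftarrow> [1..<Suc r]] @
     [X i. i \<leftarrow> [1..<Suc n]] @
     [Z i b. i \<leftarrow> [1..<Suc n], b \<leftarrow> [1..<Suc s]]"

end

theory Submission
  imports Defs
begin

text \<open>
  All points sampled by the iterated \<open>q\<close>-integrals are powers of \<open>q\<close>. Between two such points
  \<open>q ^ A \<le> q ^ B\<close> a \<open>q\<close>-integral is the sum of \<open>(1 - q) * q ^ i\<close> times the integrand over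
  \<open>B \<le> i < A\<close>, so an iterated \<open>q\<close>-integral over an order polytope is a weighted sum over
  order-reversing exponents, in the manner of \<open>P\<close>-partitions: the relation between two comparable
  elements is strict if the smaller one is integrated outside the larger one. Given the exponents of
  the \<open>x\<^sub>i\<close>, the sum over the remaining elements of the Selberg poset factors over its chains.
  The chains from \<open>x\<^sub>i\<close> to \<open>x\<^sub>j\<close> are weak in one direction and strict in the other and yield
  the two halves of the product of the \<open>x\<^sub>j - q ^ l * x\<^sub>i\<close>, with the factor \<open>l = 0\<close> occurring
  twice, once for the Vandermonde factor; the chains below and above \<open>x\<^sub>i\<close> yield its power and
  the shifted factorial. Each chain sum telescopes.
\<close>

section \<open>Iterated q-integrals over order polytopes\<close>

text \<open>Two infinite processes need control. A q-integral from \<open>a > 0\<close> is a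
  difference of series that both run below \<open>a\<close>. There an inner integral is 0, because
  its outer values already violate a relation, while an innermost integrand is merely bounded; in
  both cases the sampled terms tend to 0. All nested sums may be rearranged because the weights
  behave like a product of geometric probability laws: their total is at most 1, so bounded summands
  converge absolutely. After this conversion the order of integration survives only in the choice of
  strict and weak relations. The summation order is then free, and the exponents of the
  \<open>X i\<close> can form the outer sum although the \<open>Z i b\<close> are integrated outside
  them. The constants are local: every chain of length \<open>l\<close> contributes the factor
  \<open>q_fact q l\<close>, and every pair \<open>i < j\<close> contributes \<open>q\<close> to the
  power \<open>- (m choose 2)\<close>, from clearing the negative powers of \<open>q\<close> in its
  product.\<close>

definition lattice_weight :: "real \<Rightarrow> 'a set \<Rightarrow> ('a \<Rightarrow> nat) \<Rightarrow> real" where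
  "lattice_weight q P k = (\<Prod>v\<in>P. (1 - q) * q ^ k v)"

definition lattice_point :: "real \<Rightarrow> 'a set \<Rightarrow> ('a \<Rightarrow> nat) \<Rightarrow> 'a \<Rightarrow> real" where
  "lattice_point q P k = (\<lambda>v. if v \<in> P then q ^ k v else undefined)"

lemma lattice_weight_cong:
  "(\<And>v. v \<in> P \<Longrightarrow> k v = k' v) \<Longrightarrow> lattice_weight q P k = lattice_weight q P k'"
  by (simp add: lattice_weight_def)

lemma lattice_weight_nonneg:
  "0 < q \<Longrightarrow> q < 1 \<Longrightarrow> lattice_weight q P k \<ge> 0"
  unfolding lattice_weight_def by (intro prod_nonneg) auto

text \<open>\<open>G\<close> lies in a finite box, over which the sum factors into truncated
  geometric series, each equal to \<open>1 - q ^ N\<close>.\<close>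

lemma lattice_weight_sum_le_1:
  fixes q :: real
  assumes q: "0 < q" "q < 1" and P: "finite P" and G: "finite G" "G \<subseteq> P \<rightarrow>\<^sub>E UNIV"
  shows "sum (lattice_weight q P) G \<le> 1"
proof -
  \<comment> \<open>The inserted 0 keeps \<open>Max\<close> meaningful when \<open>G\<close> or
    \<open>P\<close> is empty.\<close>
  define N where "N = Suc (Max ((\<lambda>(k, v). k v) ` (G \<times> P) \<union> {0}))"
  have bound: "k v < N" if "k \<in> G" "v \<in> P" for k v
  proof -
    have "k v \<le> Max ((\<lambda>(k, v). k v) ` (G \<times> P) \<union> {0})"
      using that G(1) P by (intro Max_ge) auto
    then show ?thesis by (simp add: N_def)
  qed
  have sub: "G \<subseteq> Pi\<^sub>E P (\<lambda>_. {..<N})"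
    using G(2) bound by (auto simp: PiE_iff)
  have fin: "finite (Pi\<^sub>E P (\<lambda>_. {..<N}))"
    using P by (intro finite_PiE) auto
  have "sum (lattice_weight q P) G \<le> sum (lattice_weight q P) (Pi\<^sub>E P (\<lambda>_. {..<N}))"
    using sub fin q by (intro sum_mono2) (auto intro: lattice_weight_nonneg)
  also have "\<dots> = (\<Prod>v\<in>P. \<Sum>t<N. (1 - q) * q ^ t)"
    unfolding lattice_weight_def using P by (subst prod_sum_PiE) auto
  also have "\<dots> = (\<Prod>v\<in>P. 1 - q ^ N)"
  proof -
    have "(\<Sum>t<N. (1 - q) * q ^ t) = 1 - q ^ N"
      by (metis one_diff_power_eq sum_distrib_left)
    then show ?thesis by simp
  qed
  also have "\<dots> \<le> 1"
    using q by (intro prod_le_1) (auto simp: power_le_one)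
  finally show ?thesis .
qed

lemma lattice_weight_summable:
  fixes q :: real
  assumes q: "0 < q" "q < 1" and P: "finite P" and K: "K \<subseteq> P \<rightarrow>\<^sub>E UNIV"
  shows "lattice_weight q P summable_on K"
proof (rule nonneg_bounded_partial_sums_imp_summable_on)
  show "\<forall>\<^sub>F G in finite_subsets_at_top K. sum (lattice_weight q P) G \<le> 1"
    using lattice_weight_sum_le_1[OF q P] K
    by (intro eventually_finite_subsets_at_top_weakI) auto
qed (use q in \<open>auto intro: lattice_weight_nonneg\<close>)

lemma lattice_weight_infsum_le_1:
  fixes q :: real
  assumes q: "0 < q" "q < 1" and P: "finite P" and K: "K \<subseteq> P \<rightarrow>\<^sub>E UNIV"
  shows "infsum (lattice_weight q P) K \<le> 1"
  using lattice_weight_sum_le_1[OF q P] K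
  by (intro infsum_le_finite_sums lattice_weight_summable[OF assms]) auto

text \<open>The source of absolute convergence for every exchange of summations below.\<close>

lemma bounded_lattice_weight_summable:
  fixes q :: real
  assumes q: "0 < q" "q < 1" and P: "finite P" and K: "K \<subseteq> P \<rightarrow>\<^sub>E UNIV"
    and h: "\<And>k. k \<in> K \<Longrightarrow> \<bar>h k\<bar> \<le> M"
  shows "(\<lambda>k. h k * lattice_weight q P k) summable_on K"
proof (rule Infinite_Sum.abs_summable_summable, rule Infinite_Sum.abs_summable_on_comparison_test'[where g = "\<lambda>k. M * lattice_weight q P k"])
  show "(\<lambda>k. M * lattice_weight q P k) summable_on K"
    by (intro summable_on_cmult_right lattice_weight_summable[OF q P K])
  show "norm (h k * lattice_weight q P k) \<le> M * lattice_weight q P k" if "k \<in> K" for k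
    using h[OF that] lattice_weight_nonneg[OF q, of P k]
    by (auto simp: abs_mult intro!: mult_right_mono)
qed

section \<open>One-dimensional q-integrals between powers of \<open>q\<close>\<close>

text \<open>With lower limit 0 the subtracted terms vanish, and what remains is the series over the
  exponents from \<open>B\<close> on.\<close>

lemma q_integral_lattice_0:
  assumes h: "(\<lambda>i. g (q ^ i) * q ^ i) summable_on {B..}"
  shows "q_integral q 0 (q ^ B) g = (1 - q) * infsum (\<lambda>i. g (q ^ i) * q ^ i) {B..}"
proof -
  have bij: "bij_betw (\<lambda>i. B + i) UNIV {B..}"
    by (rule bij_betwI[where g = "\<lambda>i. i - B"]) auto
  have "(\<lambda>i. g (q ^ (B + i)) * q ^ (B + i)) summable_on UNIV"
    using summable_on_reindex_bij_betw[OF bij, of "\<lambda>i. g (q ^ i) * q ^ i"] h by simp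
  then have "(\<lambda>i. g (q ^ (B + i)) * q ^ (B + i)) sums
      infsum (\<lambda>i. g (q ^ (B + i)) * q ^ (B + i)) UNIV"
    by (intro has_sum_imp_sums) auto
  also have "infsum (\<lambda>i. g (q ^ (B + i)) * q ^ (B + i)) UNIV = infsum (\<lambda>i. g (q ^ i) * q ^ i) {B..}"
    using infsum_reindex_bij_betw[OF bij, of "\<lambda>i. g (q ^ i) * q ^ i"] .
  finally show ?thesis
    by (simp add: q_integral_def power_add sums_iff)
qed

text \<open>The two tails cancel, so the integrand below \<open>q ^ A\<close> matters only through its limit.\<close>

lemma q_integral_lattice:
  assumes "B \<le> A" and lim: "(\<lambda>i. g (q ^ i) * q ^ i) \<longlonglongrightarrow> 0"
  shows "q_integral q (q ^ A) (q ^ B) g = (1 - q) * (\<Sum>i\<in>{B..<A}. g (q ^ i) * q ^ i)"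
proof -
  define h where "h i = g (q ^ i) * q ^ i" for i
  \<comment> \<open>A window of length \<open>A - B\<close>: moving it by one place drops the term
    at \<open>B + i\<close> and gains the one at \<open>A + i\<close>, so the paired terms of the
    q-integral telescope.\<close>
  define H where "H i = (\<Sum>j<A - B. h (B + i + j))" for i
  have "(\<lambda>i. h (B + i + j)) \<longlonglongrightarrow> 0" for j
    using LIMSEQ_ignore_initial_segment[OF lim, of "B + j"] by (simp add: h_def ac_simps)
  then have "H \<longlonglongrightarrow> (\<Sum>j<A - B. 0)"
    unfolding H_def by (intro tendsto_sum)
  then have "(\<lambda>i. H i - H (Suc i)) sums (H 0 - 0)"
    by (intro telescope_sums') simp
  also have "(\<lambda>i. H i - H (Suc i)) = (\<lambda>i. h (B + i) - h (A + i))"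
  proof
    fix i
    have "H i - H (Suc i) = - (\<Sum>j<A - B. h (B + i + Suc j) - h (B + i + j))"
      by (simp add: H_def sum_subtractf)
    also have "\<dots> = h (B + i) - h (A + i)"
      using \<open>B \<le> A\<close> by (subst sum_lessThan_telescope) (simp add: ac_simps)
    finally show "H i - H (Suc i) = h (B + i) - h (A + i)" .
  qed
  also have "H 0 - 0 = (\<Sum>i\<in>{B..<A}. h i)"
    using sum.shift_bounds_nat_ivl[of h 0 B "A - B"] \<open>B \<le> A\<close>
    by (simp add: H_def lessThan_atLeast0 ac_simps)
  finally show ?thesis
    by (simp add: q_integral_def h_def power_add sums_iff)
qed

section \<open>Iterated q-integrals as sums over exponents\<close>

text \<open>Variables not yet fixed impose nothing beyond the direct relations between
  \<open>v\<close> and \<open>F\<close>: any monotone assignment on \<open>insert v F\<close>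
  extends to a point of the polytope, by transitivity.\<close>

lemma allowed_values_order_polytope:
  assumes P: "finite P" and refl: "\<And>a. a \<in> P \<Longrightarrow> (a, a) \<in> le" and trans: "trans le"
    and F: "F \<subseteq> P" and v: "v \<in> P" "v \<notin> F"
    and u: "\<And>w. w \<in> F \<Longrightarrow> 0 \<le> u w \<and> u w \<le> 1"
    and mono: "\<And>a b. a \<in> F \<Longrightarrow> b \<in> F \<Longrightarrow> (a, b) \<in> le \<Longrightarrow> u a \<le> u b"
  shows "allowed_values (order_polytope P le) F u v =
    {t. 0 \<le> t \<and> t \<le> 1 \<and> (\<forall>w\<in>F. ((w, v) \<in> le \<longrightarrow> u w \<le> t) \<and> ((v, w) \<in> le \<longrightarrow> t \<le> u w))}"
    (is "_ = ?T")
proof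
  show "allowed_values (order_polytope P le) F u v \<subseteq> ?T"
    using F v unfolding allowed_values_def order_polytope_def by (force simp: PiE_iff)
  show "?T \<subseteq> allowed_values (order_polytope P le) F u v"
  proof
    fix t assume t: "t \<in> ?T"
    define u' where "u' = u(v := t)"
    \<comment> \<open>Taking \<open>Max (low w)\<close> gives the least monotone extension with
      nonnegative values. The 0 serves elements with nothing fixed below them.\<close>
    define low where "low w = insert 0 (u' ` {a \<in> insert v F. (a, w) \<in> le})" for w
    define p where "p = (\<lambda>w\<in>P. Max (low w))"
    have fin: "finite (low w)" for w
      unfolding low_def using finite_subset[OF F P] by auto
    have mono': "u' a \<le> u' b" if "a \<in> insert v F" "b \<in> insert v F" "(a, b) \<in> le" for a b
      using that t v mono by (auto simp: u'_def)
    have u': "0 \<le> u' w" "u' w \<le> 1" if "w \<in> insert v F" for w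
      using that t u by (auto simp: u'_def)
    have p_eq: "p w = u' w" if w: "w \<in> insert v F" for w
    proof -
      have "w \<in> P" using w F v by auto
      moreover have "Max (low w) = u' w"
        using w \<open>w \<in> P\<close> refl u' mono' by (intro Max_eqI fin) (auto simp: low_def)
      ultimately show ?thesis by (simp add: p_def)
    qed
    have "p \<in> order_polytope P le"
      unfolding order_polytope_def
    proof (intro CollectI conjI ballI impI)
      show "p \<in> P \<rightarrow>\<^sub>E {0..1}"
      proof (rule PiE_I)
        fix w assume w: "w \<in> P"
        have "Max (low w) \<in> low w"
          using fin by (intro Max_in) (auto simp: low_def)
        then show "p w \<in> {0..1}"
          using w u' by (auto simp: p_def low_def)
      qed (auto simp: p_def)
      fix a b assume ab: "a \<in> P" "b \<in> P" "(a, b) \<in> le"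
      have "low a \<subseteq> low b"
        using ab(3) trans by (auto simp: low_def dest: transD)
      then have "Max (low a) \<le> Max (low b)"
        using fin by (intro Max_mono) (auto simp: low_def)
      then show "p a \<le> p b"
        using ab by (simp add: p_def)
    qed
    moreover have "p v = t" "\<forall>w\<in>F. p w = u w"
      using p_eq v by (auto simp: u'_def)
    ultimately show "t \<in> allowed_values (order_polytope P le) F u v"
      unfolding allowed_values_def by blast
  qed
qed

text \<open>
  The values are powers of \<open>q\<close>, so the order of the exponents is opposite to that of the values.
  A bound of \<open>v\<close> from below by a variable \<open>w\<close> integrated outside \<open>v\<close> (\<open>\<omega> v < \<omega> w\<close>) becomes
  strict, because \<open>q_integral q a b\<close> counts the lattice points in the half-open interval from
  \<open>a\<close> (excluded) to \<open>b\<close>.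
\<close>

definition completions ::
    "'a set \<Rightarrow> ('a \<times> 'a) set \<Rightarrow> ('a \<Rightarrow> nat) \<Rightarrow> 'a set \<Rightarrow> 'a set \<Rightarrow> ('a \<Rightarrow> nat) \<Rightarrow> ('a \<Rightarrow> nat) set" where
  "completions P le \<omega> V F k =
    {k' \<in> P \<rightarrow>\<^sub>E UNIV. (\<forall>w\<in>F. k' w = k w) \<and>
       (\<forall>v\<in>V. \<forall>w\<in>P. \<omega> v < \<omega> w \<longrightarrow>
          ((w, v) \<in> le \<longrightarrow> k' v < k' w) \<and> ((v, w) \<in> le \<longrightarrow> k' w \<le> k' v))}"

text \<open>Handles sample points below the lower limit. At least one variable must remain, because
  only an integral tests for an empty set of allowed values; the bare integrand \<open>f\<close>
  does not.\<close>

lemma iter_q_integral_infeasible: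
  assumes "vs \<noteq> []" "F \<subseteq> P" "a \<in> F" "b \<in> F" "(a, b) \<in> le" "u b < u a"
  shows "iter_q_integral q (order_polytope P le) f vs F u = 0"
proof (cases vs)
  case (Cons v vs')
  have "allowed_values (order_polytope P le) F u v = {}"
  proof (rule ccontr)
    assume "allowed_values (order_polytope P le) F u v \<noteq> {}"
    then obtain p where "p \<in> order_polytope P le" "\<forall>w\<in>F. p w = u w"
      unfolding allowed_values_def by blast
    moreover have "a \<in> P" "b \<in> P"
      using assms by auto
    ultimately have "p a \<le> p b" "p a = u a" "p b = u b"
      using \<open>(a, b) \<in> le\<close> \<open>a \<in> F\<close> \<open>b \<in> F\<close> unfolding order_polytope_def by blast+
    then show False using assms by simp
  qed
  then show ?thesis using Cons by simp
qed (use assms in simp)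


text \<open>The weight of \<open>F\<close> on the left makes the claim inductive: fixing
  \<open>v\<close> at \<open>q ^ i\<close> moves the factor \<open>(1 - q) * q ^ i\<close> of the
  q-integral into that weight. The bound on \<open>f\<close> gives absolute convergence, hence the
  exchange of sums, and the limit 0 for the innermost integral.\<close>

lemma iter_q_integral_order_polytope:
  fixes q :: real and \<omega> :: "'a \<Rightarrow> nat"
  assumes q: "0 < q" "q < 1" and P: "finite P"
    and refl: "\<And>a. a \<in> P \<Longrightarrow> (a, a) \<in> le" and trans: "trans le"
    and f: "\<And>u. (\<And>v. v \<in> P \<Longrightarrow> 0 < u v \<and> u v \<le> 1) \<Longrightarrow> \<bar>f u\<bar> \<le> M"
    and "sorted_wrt (\<lambda>a b. \<omega> b < \<omega> a) vs"
    and "\<And>v w. v \<in> set vs \<Longrightarrow> w \<in> F \<Longrightarrow> \<omega> v < \<omega> w" and "F \<union> set vs = P"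
    and "\<And>a b. a \<in> F \<Longrightarrow> b \<in> F \<Longrightarrow> (a, b) \<in> le \<Longrightarrow> k b \<le> k a"
  shows "lattice_weight q F k * iter_q_integral q (order_polytope P le) f vs F (lattice_point q F k) =
    infsum (\<lambda>k'. f (lattice_point q P k') * lattice_weight q P k') (completions P le \<omega> (set vs) F k)"
  using assms(7-)
proof (induction vs arbitrary: F k)
  case Nil
  then have "completions P le \<omega> (set []) F k = {restrict k P}"
    by (auto simp: completions_def fun_eq_iff PiE_iff extensional_def restrict_def)
  moreover have "lattice_point q P (restrict k P) = lattice_point q F k"
    and "lattice_weight q P (restrict k P) = lattice_weight q F k"
    using Nil by (auto simp: lattice_point_def lattice_weight_def fun_eq_iff)
  ultimately show ?case
    by (simp add: mult.commute)
next
  case (Cons v vs)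
  have vF: "v \<notin> F" and vP: "v \<in> P" and FP: "F \<subseteq> P" and finF: "finite F"
    using Cons.prems P finite_subset[of F P] by fastforce+
  define D where "D = order_polytope P le"
  define h where "h k' = f (lattice_point q P k') * lattice_weight q P k'" for k'
  define C where "C i = completions P le \<omega> (set vs) (insert v F) (k(v := i))" for i
  \<comment> \<open>These are all the conditions on the exponent of \<open>v\<close>, since every
    element of larger rank already lies in \<open>F\<close>.\<close>
  define adm where
    "adm = {i. \<forall>w\<in>F. ((w, v) \<in> le \<longrightarrow> i < k w) \<and> ((v, w) \<in> le \<longrightarrow> k w \<le> i)}"
  define u where "u = lattice_point q F k"
  define g where "g t = iter_q_integral q D f vs (insert v F) (u(v := t))" for t
  \<comment> \<open>The tightest upper limit has the largest exponent; the inserted 0 stands for the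
    bound by 1 = \<open>q ^ 0\<close>.\<close>
  define B where "B = Max (insert 0 (k ` {w \<in> F. (v, w) \<in> le}))"
  have B_le_iff: "B \<le> i \<longleftrightarrow> (\<forall>w\<in>F. (v, w) \<in> le \<longrightarrow> k w \<le> i)" for i
    unfolding B_def using finF by (subst Max_le_iff) auto
  have K: "completions P le \<omega> (set (v # vs)) F k \<subseteq> P \<rightarrow>\<^sub>E UNIV"
    by (auto simp: completions_def)
  have h_summable: "h summable_on completions P le \<omega> (set (v # vs)) F k"
    unfolding h_def using q
    by (intro bounded_lattice_weight_summable[OF q P K, of _ M] f)
      (auto simp: lattice_point_def power_le_one)
  \<comment> \<open>A completion is split into its exponent at \<open>v\<close> and itself as a
    completion with \<open>v\<close> fixed.\<close>
  have bij: "bij_betw snd (Sigma adm C) (completions P le \<omega> (set (v # vs)) F k)"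
  proof (rule bij_betwI[where g = "\<lambda>k'. (k' v, k')"])
    show "snd \<in> Sigma adm C \<rightarrow> completions P le \<omega> (set (v # vs)) F k"
    proof
      fix x assume "x \<in> Sigma adm C"
      then obtain i k' where x: "x = (i, k')" "i \<in> adm" "k' \<in> C i" by auto
      then have "k' v = i" "\<And>w. w \<in> F \<Longrightarrow> k' w = k w"
        using vF by (auto simp: C_def completions_def)
      moreover have "w \<in> F" if "\<omega> v < \<omega> w" "w \<in> P" for w
        using that Cons.prems by force
      ultimately show "snd x \<in> completions P le \<omega> (set (v # vs)) F k"
        using x by (fastforce simp: C_def completions_def adm_def)
    qed
    show "(\<lambda>k'. (k' v, k')) \<in> completions P le \<omega> (set (v # vs)) F k \<rightarrow> Sigma adm C"
    proof
      fix k' assume k': "k' \<in> completions P le \<omega> (set (v # vs)) F k"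
      have "k' v \<in> adm"
        using k' FP Cons.prems(2)[of v] by (fastforce simp: adm_def completions_def)
      moreover have "k' \<in> C (k' v)"
        using k' vF by (auto simp: C_def completions_def)
      ultimately show "(k' v, k') \<in> Sigma adm C" by simp
    qed
  qed (use vF in \<open>auto simp: C_def completions_def\<close>)
  have step: "infsum h (C i) = lattice_weight q F k * (1 - q) * (g (q ^ i) * q ^ i)"
    if i: "i \<in> adm" for i
  proof -
    have le_refl_k: "(k(v := i)) b \<le> (k(v := i)) a"
      if "a \<in> insert v F" "b \<in> insert v F" "(a, b) \<in> le" for a b
      using that i Cons.prems(4) vF by (force simp: adm_def)
    have "lattice_weight q (insert v F) (k(v := i)) *
        iter_q_integral q D f vs (insert v F) (lattice_point q (insert v F) (k(v := i))) =
        infsum h (C i)"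
      unfolding C_def h_def D_def using Cons.prems le_refl_k
      by (intro Cons.IH) auto
    moreover have "lattice_point q (insert v F) (k(v := i)) = u(v := q ^ i)"
      by (auto simp: lattice_point_def u_def fun_eq_iff)
    moreover have "lattice_weight q F (k(v := i)) = lattice_weight q F k"
      using vF by (intro lattice_weight_cong) auto
    then have "lattice_weight q (insert v F) (k(v := i)) = (1 - q) * q ^ i * lattice_weight q F k"
      using vF finF by (simp add: lattice_weight_def)
    ultimately show ?thesis
      by (simp add: g_def mult_ac)
  qed
  have summable_Sigma: "(\<lambda>(i, k'). h k') summable_on Sigma adm C"
    using summable_on_reindex_bij_betw[OF bij, of h] h_summable by (simp add: case_prod_beta')
  have "infsum h (completions P le \<omega> (set (v # vs)) F k) = infsum (\<lambda>(i, k'). h k') (Sigma adm C)"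
    using infsum_reindex_bij_betw[OF bij, of h] by (simp add: case_prod_beta')
  also have "\<dots> = infsum (\<lambda>i. infsum h (C i)) adm"
    using infsum_Sigma'_banach[OF summable_Sigma] by simp
  also have "\<dots> = infsum (\<lambda>i. lattice_weight q F k * (1 - q) * (g (q ^ i) * q ^ i)) adm"
    using step by (intro infsum_cong) auto
  also have "\<dots> = lattice_weight q F k * ((1 - q) * infsum (\<lambda>i. g (q ^ i) * q ^ i) adm)"
    by (simp add: infsum_cmult_right' mult.assoc)
  finally have rhs: "infsum h (completions P le \<omega> (set (v # vs)) F k) =
    lattice_weight q F k * ((1 - q) * infsum (\<lambda>i. g (q ^ i) * q ^ i) adm)" .
  \<comment> \<open>Cancelling this constant recovers the summability of the integrand, which the
    case of lower limit 0 takes as a hypothesis.\<close>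
  have weight_pos: "lattice_weight q F k * (1 - q) \<noteq> 0"
    using q finF by (auto simp: lattice_weight_def)
  have "(\<lambda>i. infsum h (C i)) summable_on adm"
    using summable_on_Sigma_banach[OF summable_Sigma] by simp
  then have "(\<lambda>i. lattice_weight q F k * (1 - q) * (g (q ^ i) * q ^ i)) summable_on adm"
    using step by (subst (asm) summable_on_cong) auto
  then have g_summable: "(\<lambda>i. g (q ^ i) * q ^ i) summable_on adm"
    using summable_on_cmult_right'[OF weight_pos] by blast
  have uF: "u w = q ^ k w" if "w \<in> F" for w
    using that by (simp add: u_def lattice_point_def)
  have A: "allowed_values D F u v =
    {t. 0 \<le> t \<and> t \<le> 1 \<and> (\<forall>w\<in>F. ((w, v) \<in> le \<longrightarrow> u w \<le> t) \<and> ((v, w) \<in> le \<longrightarrow> t \<le> u w))}"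
    unfolding D_def using q Cons.prems(4)
    by (intro allowed_values_order_polytope P refl trans FP vP vF)
      (auto simp: uF power_le_one power_decreasing)
  have upper: "t \<le> q ^ B \<longleftrightarrow> t \<le> 1 \<and> (\<forall>w\<in>F. (v, w) \<in> le \<longrightarrow> t \<le> u w)" for t
  proof
    assume t: "t \<le> q ^ B"
    moreover have "q ^ B \<le> q ^ k w" if "w \<in> F" "(v, w) \<in> le" for w
      using that B_le_iff[of B] q by (intro power_decreasing) auto
    ultimately show "t \<le> 1 \<and> (\<forall>w\<in>F. (v, w) \<in> le \<longrightarrow> t \<le> u w)"
      using power_le_one[of q B] q by (fastforce simp: uF intro: order_trans)
  next
    assume t: "t \<le> 1 \<and> (\<forall>w\<in>F. (v, w) \<in> le \<longrightarrow> t \<le> u w)"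
    have "B \<in> insert 0 (k ` {w \<in> F. (v, w) \<in> le})"
      unfolding B_def using finF by (intro Max_in) auto
    then show "t \<le> q ^ B"
      using t by (auto simp: uF)
  qed
  have qint: "iter_q_integral q D f (v # vs) F u = (1 - q) * infsum (\<lambda>i. g (q ^ i) * q ^ i) adm"
  proof (cases "\<exists>w\<in>F. (w, v) \<in> le")
    case False
    have "allowed_values D F u v = {0..q ^ B}"
      unfolding A using False upper by auto
    moreover have "adm = {B..}"
      using False B_le_iff by (auto simp: adm_def)
    ultimately show ?thesis
      using q_integral_lattice_0[of g q B] g_summable q
      by (simp add: g_def[abs_def])
  next
    case True
    define A where "A = Min (k ` {w \<in> F. (w, v) \<in> le})"
    have less_A_iff: "i < A \<longleftrightarrow> (\<forall>w\<in>F. (w, v) \<in> le \<longrightarrow> i < k w)" for i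
      unfolding A_def using finF True by (subst Min_gr_iff) auto
    have "A \<in> k ` {w \<in> F. (w, v) \<in> le}"
      unfolding A_def using finF True by (intro Min_in) auto
    then obtain a where a: "a \<in> F" "(a, v) \<in> le" "k a = A" by auto
    \<comment> \<open>A fixed lower bound \<open>a\<close> and a fixed upper bound \<open>w\<close>
      of \<open>v\<close> are related by transitivity, so their exponents are already in
      order.\<close>
    have "B \<le> A"
      using a Cons.prems(4) trans by (subst B_le_iff) (auto dest: transD)
    have lower: "q ^ A \<le> t \<longleftrightarrow> (\<forall>w\<in>F. (w, v) \<in> le \<longrightarrow> u w \<le> t)" for t
    proof
      assume t: "q ^ A \<le> t"
      have "A \<le> k w" if "w \<in> F" "(w, v) \<in> le" for w
        using that less_A_iff[of "k w"] by (meson leI less_irrefl)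
      then have "q ^ k w \<le> q ^ A" if "w \<in> F" "(w, v) \<in> le" for w
        using that q by (intro power_decreasing) auto
      then show "\<forall>w\<in>F. (w, v) \<in> le \<longrightarrow> u w \<le> t"
        using t by (force simp: uF)
    qed (use a uF in auto)
    have "allowed_values D F u v = {q ^ A..q ^ B}"
      unfolding \<open>allowed_values D F u v = _\<close> using upper lower q
      by (auto intro: order_trans[of 0 "q ^ A"])
    moreover have "q ^ A \<le> q ^ B"
      using \<open>B \<le> A\<close> q by (intro power_decreasing) auto
    moreover have "adm = {B..<A}"
      using B_le_iff less_A_iff by (auto simp: adm_def)
    \<comment> \<open>If \<open>v\<close> is innermost, the integrand is bounded by
      \<open>M\<close>; otherwise the remaining integral vanishes as soon as \<open>i\<close>
      exceeds \<open>A\<close>.\<close>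
    moreover have "(\<lambda>i. g (q ^ i) * q ^ i) \<longlonglongrightarrow> 0"
    proof (cases "vs = []")
      case True
      have "\<bar>g (q ^ i)\<bar> \<le> M" for i
      proof -
        have "\<bar>f (u(v := q ^ i))\<bar> \<le> M"
        proof (rule f)
          fix w assume "w \<in> P"
          then show "0 < (u(v := q ^ i)) w \<and> (u(v := q ^ i)) w \<le> 1"
            using Cons.prems(3) True q uF by (auto simp: power_le_one)
        qed
        then show ?thesis using True by (simp add: g_def)
      qed
      then have "\<forall>\<^sub>F i in sequentially. norm (g (q ^ i) * q ^ i) \<le> M * q ^ i"
        using q by (intro always_eventually) (auto simp: abs_mult intro!: mult_right_mono)
      moreover have "(\<lambda>i. M * q ^ i) \<longlonglongrightarrow> 0"
        using q by (intro tendsto_mult_right_zero LIMSEQ_realpow_zero) auto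
      ultimately show ?thesis
        by (rule Lim_null_comparison)
    next
      case False
      have "g (q ^ i) = 0" if "A < i" for i
      proof -
        have "q ^ i < q ^ A" using that q by (intro power_strict_decreasing) auto
        then show ?thesis
          unfolding g_def D_def using False FP vP a vF
          by (intro iter_q_integral_infeasible[where a = a and b = v]) (auto simp: uF)
      qed
      then have "\<forall>\<^sub>F i in sequentially. g (q ^ i) * q ^ i = 0"
        by (intro eventually_sequentiallyI[of "Suc A"]) auto
      then show ?thesis
        by (rule tendsto_eventually)
    qed
    ultimately show ?thesis
      using q_integral_lattice[OF \<open>B \<le> A\<close>, of g q]
      by (simp add: g_def[abs_def])
  qed
  show ?case
    using rhs[folded qint, symmetric] unfolding h_def[abs_def] D_def u_def .
qed

text \<open>The case of \<open>completions\<close> in which every element is still free and nothing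
  is prescribed.\<close>

definition compatible :: "'a set \<Rightarrow> ('a \<times> 'a) set \<Rightarrow> ('a \<Rightarrow> nat) \<Rightarrow> ('a \<Rightarrow> nat) set" where
  "compatible P le \<omega> =
    {k \<in> P \<rightarrow>\<^sub>E UNIV. \<forall>v\<in>P. \<forall>w\<in>P. \<omega> v < \<omega> w \<longrightarrow>
       ((w, v) \<in> le \<longrightarrow> k v < k w) \<and> ((v, w) \<in> le \<longrightarrow> k w \<le> k v)}"

text \<open>Serves both sides of the final identity, since the ordered simplex is the order polytope
  of a chain. With nothing fixed at the start, the weight of the empty set is 1 and the exponents
  \<open>undefined\<close> are never consulted.\<close>

theorem multi_q_integral_order_polytope:
  fixes q :: real and \<omega> :: "'a \<Rightarrow> nat"
  assumes q: "0 < q" "q < 1"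
    and refl: "\<And>a. a \<in> set vs \<Longrightarrow> (a, a) \<in> le" and trans: "trans le"
    and f: "\<And>u. (\<And>v. v \<in> set vs \<Longrightarrow> 0 < u v \<and> u v \<le> 1) \<Longrightarrow> \<bar>f u\<bar> \<le> M"
    and sorted: "sorted_wrt (\<lambda>a b. \<omega> a < \<omega> b) vs"
  shows "multi_q_integral q (order_polytope (set vs) le) f vs =
    infsum (\<lambda>k. f (lattice_point q (set vs) k) * lattice_weight q (set vs) k)
      (compatible (set vs) le \<omega>)"
proof -
  have "lattice_weight q ({} :: 'a set) undefined *
      iter_q_integral q (order_polytope (set vs) le) f (rev vs) {} (lattice_point q {} undefined) =
      infsum (\<lambda>k. f (lattice_point q (set vs) k) * lattice_weight q (set vs) k)
        (completions (set vs) le \<omega> (set (rev vs)) {} undefined)"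
  proof (rule iter_q_integral_order_polytope[where M = M])
    show "sorted_wrt (\<lambda>a b. \<omega> b < \<omega> a) (rev vs)"
      using sorted by (simp add: sorted_wrt_rev)
  qed (use q refl trans f in auto)
  then show ?thesis
    by (simp add: multi_q_integral_def lattice_weight_def lattice_point_def completions_def compatible_def)
qed

section \<open>Sums over lattice points of chains\<close>

text \<open>Fubini with a dependent fibre: \<open>merge\<close> identifies a function on the
  disjoint union with its two restrictions. The fibre varies with \<open>x\<close> because the
  bounds of a chain are exponents of the \<open>X i\<close>.\<close>

lemma infsum_merge:
  fixes h :: "('a \<Rightarrow> 'b) \<Rightarrow> real"
  assumes disj: "A \<inter> B = {}" and K0: "K0 \<subseteq> A \<rightarrow>\<^sub>E UNIV"
    and S: "\<And>x. x \<in> K0 \<Longrightarrow> S x \<subseteq> B \<rightarrow>\<^sub>E UNIV"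
    and K: "K = {k \<in> (A \<union> B) \<rightarrow>\<^sub>E UNIV. restrict k A \<in> K0 \<and> restrict k B \<in> S (restrict k A)}"
    and h: "h summable_on K"
  shows "infsum h K = infsum (\<lambda>x. infsum (\<lambda>y. h (merge A B (x, y))) (S x)) K0"
proof -
  have restr: "restrict x A = x" "restrict y B = y" if "x \<in> K0" "y \<in> S x" for x y
    using that K0 S by (auto simp: PiE_iff extensional_restrict subset_eq)
  have bij: "bij_betw (merge A B) (Sigma K0 S) K"
  proof (rule bij_betwI[where g = "\<lambda>k. (restrict k A, restrict k B)"])
    show "merge A B \<in> Sigma K0 S \<rightarrow> K"
    proof
      fix p assume "p \<in> Sigma K0 S"
      then obtain x y where "p = (x, y)" "x \<in> K0" "y \<in> S x" by auto
      then show "merge A B p \<in> K"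
        using disj restr by (simp add: K PiE_iff)
    qed
    show "(\<lambda>k. (restrict k A, restrict k B)) \<in> K \<rightarrow> Sigma K0 S"
      by (auto simp: K)
    show "(restrict (merge A B p) A, restrict (merge A B p) B) = p" if "p \<in> Sigma K0 S" for p
      using that disj restr by auto
    show "merge A B (restrict k A, restrict k B) = k" if "k \<in> K" for k
      using that disj by (auto simp: K PiE_iff merge_def extensional_def fun_eq_iff)
  qed
  have "(\<lambda>(x, y). h (merge A B (x, y))) summable_on Sigma K0 S"
    using summable_on_reindex_bij_betw[OF bij, of h] h by (simp add: case_prod_beta')
  then show ?thesis
    using infsum_Sigma'_banach[of "\<lambda>x y. h (merge A B (x, y))" K0 S]
      infsum_reindex_bij_betw[OF bij, of h]
    by (simp add: case_prod_beta')
qed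

lemma lattice_weight_merge:
  assumes "finite A" "finite B" "A \<inter> B = {}"
  shows "lattice_weight q (A \<union> B) (merge A B (x, y)) = lattice_weight q A x * lattice_weight q B y"
  using assms by (simp add: lattice_weight_def prod.union_disjoint)

lemma infsum_lattice_weight_merge:
  fixes q :: real
  assumes q: "0 < q" "q < 1" and fin: "finite A" "finite B"
    and disj: "A \<inter> B = {}" and K0: "K0 \<subseteq> A \<rightarrow>\<^sub>E UNIV"
    and S: "\<And>x. x \<in> K0 \<Longrightarrow> S x \<subseteq> B \<rightarrow>\<^sub>E UNIV"
    and H: "\<And>x. x \<in> K0 \<Longrightarrow> \<bar>H x\<bar> \<le> M"
    and K: "K = {k \<in> (A \<union> B) \<rightarrow>\<^sub>E UNIV. restrict k A \<in> K0 \<and> restrict k B \<in> S (restrict k A)}"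
  shows "infsum (\<lambda>k. H (restrict k A) * lattice_weight q (A \<union> B) k) K =
    infsum (\<lambda>x. H x * infsum (lattice_weight q B) (S x) * lattice_weight q A x) K0"
proof -
  have "infsum (\<lambda>k. H (restrict k A) * lattice_weight q (A \<union> B) k) K =
    infsum (\<lambda>x. infsum (\<lambda>y. H (restrict (merge A B (x, y)) A) *
      lattice_weight q (A \<union> B) (merge A B (x, y))) (S x)) K0"
    by (rule infsum_merge[OF disj K0 S K])
      (use fin H in \<open>auto intro!: bounded_lattice_weight_summable[OF q, where M = M] simp: K\<close>)
  also have "\<dots> = infsum (\<lambda>x. H x * infsum (lattice_weight q B) (S x) * lattice_weight q A x) K0"
  proof (rule infsum_cong)
    fix x assume x: "x \<in> K0"
    then have "restrict x A = x"
      using K0 by (auto simp: PiE_iff extensional_restrict subset_eq)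
    then have "infsum (\<lambda>y. H (restrict (merge A B (x, y)) A) *
        lattice_weight q (A \<union> B) (merge A B (x, y))) (S x) =
      infsum (\<lambda>y. (H x * lattice_weight q A x) * lattice_weight q B y) (S x)"
      by (simp only: lattice_weight_merge[OF fin disj] restrict_merge(1)[OF disj] mult.assoc)
    then show "infsum (\<lambda>y. H (restrict (merge A B (x, y)) A) *
        lattice_weight q (A \<union> B) (merge A B (x, y))) (S x) =
      H x * infsum (lattice_weight q B) (S x) * lattice_weight q A x"
      by (simp add: infsum_cmult_right' mult_ac)
  qed
  finally show ?thesis .
qed

text \<open>Once the exponents on \<open>D\<close> are known, the blocks are independent. The
  induction varies \<open>H\<close>: the sum over a split-off block is multiplied into
  \<open>H\<close>, and since it lies between 0 and 1 the bound \<open>M\<close> persists.\<close>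

lemma infsum_lattice_weight_blocks:
  fixes q :: real and D :: "'a set" and B :: "'i \<Rightarrow> 'a set"
  assumes q: "0 < q" "q < 1" and "finite I" and D: "finite D"
    and fin: "\<And>i. i \<in> I \<Longrightarrow> finite (B i)"
    and disj_D: "\<And>i. i \<in> I \<Longrightarrow> B i \<inter> D = {}"
    and disj: "disjoint_family_on B I"
    and S: "\<And>i x. i \<in> I \<Longrightarrow> x \<in> D \<rightarrow>\<^sub>E UNIV \<Longrightarrow> S i x \<subseteq> B i \<rightarrow>\<^sub>E UNIV"
    and H: "\<And>x. x \<in> D \<rightarrow>\<^sub>E UNIV \<Longrightarrow> \<bar>H x\<bar> \<le> M"
  shows "infsum (\<lambda>k. H (restrict k D) * lattice_weight q (D \<union> \<Union>(B ` I)) k)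
      {k \<in> (D \<union> \<Union>(B ` I)) \<rightarrow>\<^sub>E UNIV. \<forall>i\<in>I. restrict k (B i) \<in> S i (restrict k D)} =
    infsum (\<lambda>x. H x * (\<Prod>i\<in>I. infsum (lattice_weight q (B i)) (S i x)) * lattice_weight q D x)
      (D \<rightarrow>\<^sub>E UNIV)"
  using assms(3,5-)
proof (induction I arbitrary: H)
  case empty
  show ?case
    by (rule infsum_cong_neutral) (auto simp: PiE_iff extensional_restrict)
next
  case (insert i I)
  define A where "A = D \<union> \<Union>(B ` I)"
  define K0 where "K0 = {k \<in> A \<rightarrow>\<^sub>E UNIV. \<forall>j\<in>I. restrict k (B j) \<in> S j (restrict k D)}"
  have DA: "D \<inter> A = D" "A \<inter> D = D" "\<And>j. j \<in> I \<Longrightarrow> A \<inter> B j = B j"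
    by (auto simp: A_def)
  have restr: "restrict x D \<in> D \<rightarrow>\<^sub>E UNIV" for x :: "'a \<Rightarrow> nat" by auto
  have "infsum (\<lambda>k. H (restrict (restrict k A) D) * lattice_weight q (A \<union> B i) k)
      {k \<in> (A \<union> B i) \<rightarrow>\<^sub>E UNIV. restrict k A \<in> K0 \<and> restrict k (B i) \<in> S i (restrict (restrict k A) D)} =
    infsum (\<lambda>x. H (restrict x D) * infsum (lattice_weight q (B i)) (S i (restrict x D)) * lattice_weight q A x) K0"
  proof (rule infsum_lattice_weight_merge[OF q, where M = M])
    show "A \<inter> B i = {}"
      using insert.prems(2)[of i] insert.prems(3) insert.hyps
      by (auto simp: A_def disjoint_family_on_def)
    show "S i (restrict x D) \<subseteq> B i \<rightarrow>\<^sub>E UNIV" for x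
      using insert.prems(4) restr by blast
    show "\<bar>H (restrict x D)\<bar> \<le> M" for x
      using insert.prems(5) restr by blast
  qed (use insert.hyps insert.prems D in \<open>auto simp: A_def K0_def\<close>)
  also have "\<dots> = infsum (\<lambda>x. H x * infsum (lattice_weight q (B i)) (S i x) *
      (\<Prod>j\<in>I. infsum (lattice_weight q (B j)) (S j x)) * lattice_weight q D x) (D \<rightarrow>\<^sub>E UNIV)"
    unfolding K0_def A_def
  proof (rule insert.IH)
    show "disjoint_family_on B I"
      using insert.prems(3) by (auto simp: disjoint_family_on_def)
    fix x :: "'a \<Rightarrow> nat" assume x: "x \<in> D \<rightarrow>\<^sub>E UNIV"
    have "0 \<le> infsum (lattice_weight q (B i)) (S i x)"
      using q by (intro infsum_nonneg lattice_weight_nonneg)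
    moreover have "infsum (lattice_weight q (B i)) (S i x) \<le> 1"
      using insert.prems(1,4) x by (intro lattice_weight_infsum_le_1 q) auto
    ultimately have "\<bar>H x\<bar> * \<bar>infsum (lattice_weight q (B i)) (S i x)\<bar> \<le> M * 1"
      using insert.prems(5)[OF x] by (intro mult_mono) auto
    then show "\<bar>H x * infsum (lattice_weight q (B i)) (S i x)\<bar> \<le> M"
      by (simp add: abs_mult)
  qed (use insert.prems in auto)
  also have "\<dots> = infsum (\<lambda>x. H x * (\<Prod>j\<in>insert i I. infsum (lattice_weight q (B j)) (S j x)) *
      lattice_weight q D x) (D \<rightarrow>\<^sub>E UNIV)"
    using insert.hyps by (simp add: mult_ac)
  also have "infsum (\<lambda>k. H (restrict (restrict k A) D) * lattice_weight q (A \<union> B i) k)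
      {k \<in> (A \<union> B i) \<rightarrow>\<^sub>E UNIV. restrict k A \<in> K0 \<and> restrict k (B i) \<in> S i (restrict (restrict k A) D)} =
    infsum (\<lambda>k. H (restrict k D) * lattice_weight q (D \<union> \<Union>(B ` insert i I)) k)
      {k \<in> (D \<union> \<Union>(B ` insert i I)) \<rightarrow>\<^sub>E UNIV. \<forall>j\<in>insert i I. restrict k (B j) \<in> S j (restrict k D)}"
  proof -
    have eq: "A \<union> B i = D \<union> \<Union>(B ` insert i I)"
      by (auto simp: A_def)
    show ?thesis
      unfolding eq K0_def using DA
      by (intro arg_cong2[where f = infsum]) (auto simp: restrict_restrict)
  qed
  finally show ?case .
qed

section \<open>Sums over a single chain\<close>

text \<open>The list runs by increasing exponents. The gap \<open>d\<close> is 0 for weak and 1 for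
  strict relations; \<open>U\<close> is a set rather than a number so that it also covers chains
  without an upper bound.\<close>

definition lattice_chains :: "nat \<Rightarrow> nat set \<Rightarrow> nat \<Rightarrow> 'a list \<Rightarrow> ('a \<Rightarrow> nat) set" where
  "lattice_chains d U b cs =
    {k \<in> set cs \<rightarrow>\<^sub>E UNIV. successively (\<lambda>a c. k a + d \<le> k c) cs \<and> k ` set cs \<subseteq> U \<and>
       (cs \<noteq> [] \<longrightarrow> b \<le> k (hd cs))}"

definition chain_sum :: "real \<Rightarrow> nat \<Rightarrow> nat set \<Rightarrow> nat \<Rightarrow> 'a list \<Rightarrow> real" where
  "chain_sum q d U b cs = infsum (lattice_weight q (set cs)) (lattice_chains d U b cs)"

lemma restrict_in_lattice_chains:
  "restrict k (set cs) \<in> lattice_chains d U b cs \<longleftrightarrow>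
    successively (\<lambda>a c. k a + d \<le> k c) cs \<and> k ` set cs \<subseteq> U \<and> (cs \<noteq> [] \<longrightarrow> b \<le> k (hd cs))"
proof -
  have "successively (\<lambda>a c. restrict k (set cs) a + d \<le> restrict k (set cs) c) cs \<longleftrightarrow>
      successively (\<lambda>a c. k a + d \<le> k c) cs"
    by (intro successively_cong) auto
  then show ?thesis
    by (auto simp: lattice_chains_def)
qed

lemma chain_sum_Nil [simp]: "chain_sum q d U b [] = 1"
  by (simp add: chain_sum_def lattice_chains_def lattice_weight_def)

text \<open>Peels off the smallest exponent \<open>t\<close>; the rest is a chain with the same
  \<open>U\<close> that starts at \<open>t + d\<close> or later.\<close>

lemma chain_sum_Cons:
  fixes q :: real
  assumes q: "0 < q" "q < 1" and c: "c \<notin> set cs"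
  shows "chain_sum q d U b (c # cs) =
    infsum (\<lambda>t. (1 - q) * q ^ t * chain_sum q d U (t + d) cs) (U \<inter> {b..})"
proof -
  define K0 where "K0 = {x \<in> {c} \<rightarrow>\<^sub>E UNIV. x c \<in> U \<inter> {b..}}"
  have "infsum (\<lambda>k. 1 * lattice_weight q ({c} \<union> set cs) k) (lattice_chains d U b (c # cs)) =
    infsum (\<lambda>x. 1 * infsum (lattice_weight q (set cs)) (lattice_chains d U (x c + d) cs) *
      lattice_weight q {c} x) K0"
  proof (rule infsum_lattice_weight_merge[OF q, where M = 1])
    show "lattice_chains d U b (c # cs) = {k \<in> ({c} \<union> set cs) \<rightarrow>\<^sub>E UNIV. restrict k {c} \<in> K0 \<and>
        restrict k (set cs) \<in> lattice_chains d U (restrict k {c} c + d) cs}"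
      unfolding restrict_in_lattice_chains
      by (auto simp: lattice_chains_def K0_def successively_Cons)
  qed (use c in \<open>auto simp: K0_def lattice_chains_def\<close>)
  also have "\<dots> = infsum (\<lambda>x. (1 - q) * q ^ x c * chain_sum q d U (x c + d) cs) K0"
    by (simp add: chain_sum_def lattice_weight_def mult_ac)
  also have "\<dots> = infsum (\<lambda>t. (1 - q) * q ^ t * chain_sum q d U (t + d) cs) (U \<inter> {b..})"
  proof -
    have "bij_betw (\<lambda>x. x c) K0 (U \<inter> {b..})"
      by (rule bij_betwI[where g = "\<lambda>t. \<lambda>_\<in>{c}. t"])
        (auto simp: K0_def PiE_iff extensional_def fun_eq_iff restrict_def)
    from infsum_reindex_bij_betw[OF this, of "\<lambda>t. (1 - q) * q ^ t * chain_sum q d U (t + d) cs"]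
    show ?thesis .
  qed
  finally show ?thesis by (simp add: chain_sum_def)
qed

lemma chain_sum_eq_0: "cs \<noteq> [] \<Longrightarrow> a \<le> b \<Longrightarrow> chain_sum q d {..<a} b cs = 0"
proof -
  assume "cs \<noteq> []" "a \<le> b"
  have "k \<notin> lattice_chains d {..<a} b cs" for k
  proof
    assume "k \<in> lattice_chains d {..<a} b cs"
    then have "k (hd cs) < a" "b \<le> k (hd cs)"
      using \<open>cs \<noteq> []\<close> by (auto simp: lattice_chains_def image_subset_iff)
    then show False using \<open>a \<le> b\<close> by simp
  qed
  then have "lattice_chains d {..<a} b cs = {}" by blast
  then show ?thesis by (simp add: chain_sum_def)
qed

text \<open>The q-analogue of the power rule. At \<open>y = q ^ t\<close> the left side is a forward
  difference in \<open>t\<close> up to sign, which makes chain sums telescope. It holds because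
  \<open>q * y - q ^ Suc l * a\<close> is \<open>q\<close> times
  \<open>y - q ^ l * a\<close>.\<close>

lemma prod_q_difference_weak:
  fixes q :: real
  shows "(\<Prod>l<Suc m. y - q ^ l * a) - (\<Prod>l<Suc m. q * y - q ^ l * a) =
    y * (1 - q ^ Suc m) * (\<Prod>l<m. y - q ^ l * a)"
proof -
  define P where "P = (\<Prod>l<m. y - q ^ l * a)"
  have "(\<Prod>l<m. q * y - q ^ Suc l * a) = (\<Prod>l<m. q * (y - q ^ l * a))"
    by (intro prod.cong) (auto simp: algebra_simps)
  also have "\<dots> = q ^ m * P"
    by (simp add: prod.distrib P_def)
  finally have shifted: "(\<Prod>l<Suc m. q * y - q ^ l * a) = (q * y - a) * (q ^ m * P)"
    by (subst prod.lessThan_Suc_shift) simp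
  have unshifted: "(\<Prod>l<Suc m. y - q ^ l * a) = P * (y - q ^ m * a)"
    by (simp add: P_def)
  show ?thesis
    unfolding shifted unshifted P_def[symmetric] by (simp add: algebra_simps)
qed

text \<open>The product on the right is taken at \<open>q * y\<close> instead of \<open>y\<close>,
  matching a strict chain, whose next exponent is at least \<open>t + 1\<close>. Both products on
  the left share this product as a factor.\<close>

lemma prod_q_difference_strict:
  fixes q :: real
  shows "(\<Prod>l<Suc m. q ^ l * y - a) - (\<Prod>l<Suc m. q ^ l * (q * y) - a) =
    y * (1 - q ^ Suc m) * (\<Prod>l<m. q ^ l * (q * y) - a)"
proof -
  have "(\<Prod>l<Suc m. q ^ l * y - a) = (y - a) * (\<Prod>l<m. q ^ l * (q * y) - a)"
    by (subst prod.lessThan_Suc_shift) (simp add: algebra_simps)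
  then show ?thesis
    by (simp add: algebra_simps)
qed

lemma q_fact_Suc: "q_fact q (Suc m) = (1 - q ^ Suc m) / (1 - q) * q_fact q m"
  by (simp add: q_fact_def)

text \<open>Passing from \<open>q_fact q m\<close> to \<open>q_fact q (Suc m)\<close> replaces the
  weight factor \<open>1 - q\<close> of the new element by \<open>1 - q ^ Suc m\<close>, exactly
  what the q-power rule needs.\<close>

lemma chain_sum_weak:
  fixes q :: real
  assumes q: "0 < q" "q < 1" and "distinct cs" "b \<le> a"
  shows "q_fact q (length cs) * chain_sum q 0 {..<a} b cs = (\<Prod>l<length cs. q ^ b - q ^ l * q ^ a)"
  using assms(3,4)
proof (induction cs arbitrary: b)
  case Nil
  show ?case by (simp add: q_fact_def)
next
  case (Cons c cs)
  define m where "m = length cs"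
  define F where "F t = (\<Prod>l<Suc m. q ^ t - q ^ l * q ^ a)" for t
  have int: "{..<a} \<inter> {b..} = {b..<a}" by auto
  have "q_fact q (Suc m) * chain_sum q 0 {..<a} b (c # cs) =
    (\<Sum>t\<in>{b..<a}. (1 - q ^ Suc m) * q ^ t * (q_fact q m * chain_sum q 0 {..<a} t cs))"
    using q Cons.prems
    by (subst chain_sum_Cons) (auto simp: int q_fact_Suc sum_distrib_left mult_ac intro!: sum.cong)
  also have "\<dots> = (\<Sum>t\<in>{b..<a}. - (F (Suc t) - F t))"
  proof (rule sum.cong)
    fix t assume "t \<in> {b..<a}"
    then have "q_fact q m * chain_sum q 0 {..<a} t cs = (\<Prod>l<m. q ^ t - q ^ l * q ^ a)"
      unfolding m_def using Cons.prems by (intro Cons.IH) auto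
    then show "(1 - q ^ Suc m) * q ^ t * (q_fact q m * chain_sum q 0 {..<a} t cs) =
        - (F (Suc t) - F t)"
      using prod_q_difference_weak[where y = "q ^ t" and m = m and q = q and a = "q ^ a"]
      by (simp only: F_def power_Suc[of q t]) (simp add: mult_ac)
  qed simp
  also have "\<dots> = F b - F a"
    using Cons.prems by (simp only: sum_negf sum_Suc_diff')
  \<comment> \<open>The factor with \<open>l = 0\<close> is \<open>q ^ a - q ^ a\<close>.\<close>
  also have "F a = 0"
    unfolding F_def by (subst prod.lessThan_Suc_shift) simp
  finally show ?case by (simp add: F_def m_def)
qed

text \<open>The induction hypothesis is applied at \<open>Suc t\<close>, which can equal
  \<open>a\<close>, so the equality \<open>b = a\<close> has to be allowed. When the chain is too
  long for the interval, the factor with \<open>l = a - b\<close> makes the right side 0 as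
  well.\<close>

lemma chain_sum_strict:
  fixes q :: real
  assumes q: "0 < q" "q < 1" and "distinct cs" "b \<le> a"
  shows "q_fact q (length cs) * chain_sum q 1 {..<a} b cs = (\<Prod>l<length cs. q ^ l * q ^ b - q ^ a)"
  using assms(3,4)
proof (induction cs arbitrary: b)
  case Nil
  show ?case by (simp add: q_fact_def)
next
  case (Cons c cs)
  define m where "m = length cs"
  define F where "F t = (\<Prod>l<Suc m. q ^ l * q ^ t - q ^ a)" for t
  have int: "{..<a} \<inter> {b..} = {b..<a}" by auto
  have "q_fact q (Suc m) * chain_sum q 1 {..<a} b (c # cs) =
    (\<Sum>t\<in>{b..<a}. (1 - q ^ Suc m) * q ^ t * (q_fact q m * chain_sum q 1 {..<a} (Suc t) cs))"
    using q Cons.prems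
    by (subst chain_sum_Cons) (auto simp: int q_fact_Suc sum_distrib_left mult_ac intro!: sum.cong)
  also have "\<dots> = (\<Sum>t\<in>{b..<a}. - (F (Suc t) - F t))"
  proof (rule sum.cong)
    fix t assume "t \<in> {b..<a}"
    then have "q_fact q m * chain_sum q 1 {..<a} (Suc t) cs = (\<Prod>l<m. q ^ l * q ^ Suc t - q ^ a)"
      unfolding m_def using Cons.prems by (intro Cons.IH) auto
    then show "(1 - q ^ Suc m) * q ^ t * (q_fact q m * chain_sum q 1 {..<a} (Suc t) cs) =
        - (F (Suc t) - F t)"
      using prod_q_difference_strict[where y = "q ^ t" and m = m and q = q and a = "q ^ a"]
      by (simp only: F_def power_Suc[of q t]) (simp add: mult_ac)
  qed simp
  also have "\<dots> = F b - F a"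
    using Cons.prems by (simp only: sum_negf sum_Suc_diff')
  also have "F a = 0"
    unfolding F_def by (subst prod.lessThan_Suc_shift) simp
  finally show ?case by (simp add: F_def m_def)
qed

text \<open>The new element gives \<open>q ^ t\<close> and the rest \<open>(q ^ t) ^ m\<close>, so
  the sum over \<open>t\<close> is a geometric series with ratio \<open>q ^ Suc m\<close>.\<close>

lemma chain_sum_unbounded:
  fixes q :: real
  assumes q: "0 < q" "q < 1" and "distinct cs"
  shows "q_fact q (length cs) * chain_sum q 0 UNIV b cs = (q ^ b) ^ length cs"
  using assms(3)
proof (induction cs arbitrary: b)
  case Nil
  show ?case by (simp add: q_fact_def)
next
  case (Cons c cs)
  define m where "m = length cs"
  define x where "x = q ^ Suc m"
  have x: "0 \<le> x" "x < 1"
    using q power_less_one_iff[of q "Suc m"] by (auto simp: x_def)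
  have "q_fact q (Suc m) * chain_sum q 0 UNIV b (c # cs) =
    q_fact q (Suc m) * infsum (\<lambda>t. (1 - q) * q ^ t * chain_sum q 0 UNIV t cs) {b..}"
    using q Cons.prems by (subst chain_sum_Cons) auto
  also have "\<dots> = infsum (\<lambda>t. (1 - x) * x ^ t) {b..}"
    unfolding infsum_cmult_right'[symmetric]
  proof (rule infsum_cong)
    fix t
    have "q_fact q m * chain_sum q 0 UNIV t cs = (q ^ t) ^ m"
      unfolding m_def using Cons.prems by (intro Cons.IH) auto
    then have "(1 - x) * q ^ t * (q_fact q m * chain_sum q 0 UNIV t cs) = (1 - x) * x ^ t"
      by (simp add: x_def power_mult[symmetric] power_add[symmetric] algebra_simps)
    then show "q_fact q (Suc m) * ((1 - q) * q ^ t * chain_sum q 0 UNIV t cs) = (1 - x) * x ^ t"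
      using q by (simp add: q_fact_Suc x_def mult_ac)
  qed
  also have "\<dots> = infsum (\<lambda>i. (1 - x) * x ^ b * x ^ i) UNIV"
  proof -
    have "bij_betw (\<lambda>i. b + i) UNIV {b..}"
      by (rule bij_betwI[where g = "\<lambda>i. i - b"]) auto
    from infsum_reindex_bij_betw[OF this, of "\<lambda>t. (1 - x) * x ^ t"] show ?thesis
      by (simp add: power_add mult_ac)
  qed
  also have "\<dots> = (1 - x) * x ^ b * infsum (\<lambda>i. x ^ i) UNIV"
    by (rule infsum_cmult_right')
  also have "infsum (\<lambda>i. x ^ i) UNIV = 1 / (1 - x)"
    using x by (intro infsumI norm_summable_imp_has_sum geometric_sums)
      (auto intro!: summable_geometric simp: norm_power)
  finally show ?case
    using x by (simp add: m_def[symmetric] x_def power_mult_distrib power_mult[symmetric] mult.commute)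
qed

section \<open>The Selberg poset\<close>

text \<open>Generating relations suffice: if the rank drops between the ends of a path, it drops at
  some step, and that step is strict. Injectivity leaves no distinct elements of equal rank, about
  which \<open>compatible\<close> would say nothing.\<close>

lemma compatible_rtrancl:
  assumes inj: "inj_on \<omega> P" and E: "E \<subseteq> P \<times> P"
  shows "compatible P (E\<^sup>*) \<omega> =
    {k \<in> P \<rightarrow>\<^sub>E UNIV. \<forall>(a, b)\<in>E. k b \<le> k a \<and> (\<omega> b < \<omega> a \<longrightarrow> k b < k a)}"
    (is "_ = ?K")
proof
  show "compatible P (E\<^sup>*) \<omega> \<subseteq> ?K"
  proof
    fix k assume k: "k \<in> compatible P (E\<^sup>*) \<omega>"
    have "k b \<le> k a \<and> (\<omega> b < \<omega> a \<longrightarrow> k b < k a)" if ab: "(a, b) \<in> E" for a b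
    proof -
      have mem: "a \<in> P" "b \<in> P" "(a, b) \<in> E\<^sup>*" using ab E by auto
      consider "a = b" | "\<omega> a < \<omega> b" | "\<omega> b < \<omega> a"
        using mem inj by (meson inj_onD linorder_neqE_nat)
      then show ?thesis
      proof cases
        case 2
        then have "k b \<le> k a" using k mem unfolding compatible_def by blast
        with 2 show ?thesis by simp
      next
        case 3
        then have "k b < k a" using k mem unfolding compatible_def by blast
        then show ?thesis by simp
      qed simp
    qed
    then show "k \<in> ?K"
      using k by (auto simp: compatible_def)
  qed
  show "?K \<subseteq> compatible P (E\<^sup>*) \<omega>"
  proof
    fix k assume k: "k \<in> ?K"
    have "k b \<le> k a \<and> (\<omega> b < \<omega> a \<longrightarrow> k b < k a)" if "(a, b) \<in> E\<^sup>*" for a b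
      using that
    proof (induction rule: rtrancl_induct)
      case (step b c)
      then have "k c \<le> k b \<and> (\<omega> c < \<omega> b \<longrightarrow> k c < k b)"
        using k by blast
      with step.IH show ?case by linarith
    qed simp
    then show "k \<in> compatible P (E\<^sup>*) \<omega>"
      using k unfolding compatible_def by blast
  qed
qed

lemma successively_iff_zip_tl:
  "successively R c \<longleftrightarrow> (\<forall>(a, b)\<in>set (zip c (tl c)). R a b)"
  by (induction c rule: induct_list012) auto

lemma successively_map_upt:
  "successively R (map f [a..<b]) \<longleftrightarrow> (\<forall>l. a \<le> l \<and> Suc l < b \<longrightarrow> R (f l) (f (Suc l)))"
proof -
  have "successively R (map f [a..<b]) \<longleftrightarrow> (\<forall>i. Suc i < b - a \<longrightarrow> R (f (a + i)) (f (Suc (a + i))))"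
    by (auto simp: successively_conv_nth)
  also have "\<dots> \<longleftrightarrow> (\<forall>l. a \<le> l \<and> Suc l < b \<longrightarrow> R (f l) (f (Suc l)))" (is "?L \<longleftrightarrow> ?R")
  proof
    assume L: ?L
    show ?R
    proof (intro allI impI)
      fix l assume "a \<le> l \<and> Suc l < b"
      then show "R (f l) (f (Suc l))" using L[rule_format, of "l - a"] by auto
    qed
  qed auto
  finally show ?thesis .
qed

lemma image_subset_lessThan_iff_last:
  fixes k :: "'a \<Rightarrow> nat"
  assumes "successively (\<lambda>a c. k a + d \<le> k c) cs"
  shows "k ` set cs \<subseteq> {..<A} \<longleftrightarrow> (cs \<noteq> [] \<longrightarrow> k (last cs) < A)"
  using assms by (induction cs rule: induct_list012) auto

section \<open>Decomposition of the Selberg poset into blocks\<close>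

text \<open>The pieces of the poset left after deleting the \<open>X i\<close>. Both
  \<open>UpW i j\<close> and \<open>DownW i j\<close> are indexed by \<open>i < j\<close>; the
  latter holds the elements \<open>W j i k\<close>.\<close>

datatype block = UpW nat nat | DownW nat nat | ChainY nat | ChainZ nat

text \<open>Elements are listed from the top of the poset downwards, so that exponents ascend. Only
  the elements of \<open>DownW\<close> already descend as their superscript grows.\<close>

fun block_elems :: "nat \<Rightarrow> nat \<Rightarrow> nat \<Rightarrow> block \<Rightarrow> selberg_elem list" where
  "block_elems r s m (UpW i j) = map (W i j) (rev [1..<Suc m])"
| "block_elems r s m (DownW i j) = map (W j i) [1..<Suc m]"
| "block_elems r s m (ChainY i) = map (Y i) (rev [1..<Suc r])"
| "block_elems r s m (ChainZ i) = map (Z i) (rev [1..<Suc s])"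

text \<open>\<open>X i\<close> lies below the \<open>W\<close> of its pair and is integrated outside
  them, hence the strict bound by \<open>x (X i)\<close>; the bound by \<open>x (X j)\<close> is
  weak. The \<open>Z\<close> are integrated outside \<open>X i\<close>, so their relation to it is
  weak and the bound becomes \<open>Suc (x (X i))\<close>.\<close>

fun block_fillings :: "nat \<Rightarrow> nat \<Rightarrow> nat \<Rightarrow> block \<Rightarrow> (selberg_elem \<Rightarrow> nat) \<Rightarrow> (selberg_elem \<Rightarrow> nat) set" where
  "block_fillings r s m (UpW i j) x = lattice_chains 0 {..<x (X i)} (x (X j)) (block_elems r s m (UpW i j))"
| "block_fillings r s m (DownW i j) x = lattice_chains 1 {..<x (X i)} (x (X j)) (block_elems r s m (DownW i j))"
| "block_fillings r s m (ChainY i) x = lattice_chains 0 UNIV (x (X i)) (block_elems r s m (ChainY i))"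
| "block_fillings r s m (ChainZ i) x = lattice_chains 0 {..<Suc (x (X i))} 0 (block_elems r s m (ChainZ i))"

definition block_index :: "nat \<Rightarrow> block set" where
  "block_index n = (\<lambda>(i, j). UpW i j) ` index_pairs n \<union> (\<lambda>(i, j). DownW i j) ` index_pairs n \<union>
     ChainY ` {1..n} \<union> ChainZ ` {1..n}"

lemma finite_index_pairs [simp]: "finite (index_pairs n)"
  by (rule finite_subset[of _ "{1..n} \<times> {1..n}"]) (auto simp: index_pairs_def)

lemma finite_block_index [simp]: "finite (block_index n)"
  by (simp add: block_index_def)

lemma ball_block_index:
  "(\<forall>b\<in>block_index n. Q b) \<longleftrightarrow>
    (\<forall>(i, j)\<in>index_pairs n. Q (UpW i j)) \<and> (\<forall>(i, j)\<in>index_pairs n. Q (DownW i j)) \<and>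
    (\<forall>i\<in>{1..n}. Q (ChainY i) \<and> Q (ChainZ i))"
  unfolding block_index_def by (auto simp: ball_Un)

lemma prod_block_index:
  fixes g :: "block \<Rightarrow> real"
  shows "(\<Prod>b\<in>block_index n. g b) =
    (\<Prod>(i, j)\<in>index_pairs n. g (UpW i j) * g (DownW i j)) * (\<Prod>i=1..n. g (ChainY i) * g (ChainZ i))"
proof -
  define U where "U = (\<lambda>(i, j). UpW i j) ` index_pairs n"
  define V where "V = (\<lambda>(i, j). DownW i j) ` index_pairs n"
  have UV: "prod g U = (\<Prod>(i, j)\<in>index_pairs n. g (UpW i j))"
    "prod g V = (\<Prod>(i, j)\<in>index_pairs n. g (DownW i j))"
    unfolding U_def V_def
    by (subst prod.reindex; force simp: inj_on_def case_prod_beta intro!: prod.cong)+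
  have YZ: "prod g (ChainY ` {1..n}) = (\<Prod>i=1..n. g (ChainY i))"
    "prod g (ChainZ ` {1..n}) = (\<Prod>i=1..n. g (ChainZ i))"
    by (subst prod.reindex; simp add: inj_on_def)+
  have fin: "finite U" "finite V"
    by (auto simp: U_def V_def)
  have disj: "U \<inter> V = {}" "(U \<union> V) \<inter> ChainY ` {1..n} = {}"
    "(U \<union> V \<union> ChainY ` {1..n}) \<inter> ChainZ ` {1..n} = {}"
    by (auto simp: U_def V_def)
  have "prod g (block_index n) = prod g U * prod g V * prod g (ChainY ` {1..n}) * prod g (ChainZ ` {1..n})"
    unfolding block_index_def U_def[symmetric] V_def[symmetric]
    using fin disj by (simp add: prod.union_disjoint)
  then show ?thesis
    unfolding UV YZ case_prod_beta prod.distrib by (simp only: mult_ac)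
qed

lemma Union_block_elems:
  "\<Union>((\<lambda>b. set (block_elems r s m b)) ` block_index n) =
    (\<Union>(i, j)\<in>index_pairs n. W i j ` {1..m}) \<union> (\<Union>(i, j)\<in>index_pairs n. W j i ` {1..m}) \<union>
    (\<Union>i\<in>{1..n}. Y i ` {1..r}) \<union> (\<Union>i\<in>{1..n}. Z i ` {1..s})"
proof -
  have up: "set [1..<Suc a] = {1..a}" for a by auto
  show ?thesis
    unfolding block_index_def image_Un Union_Un_distrib image_image case_prod_beta
    by (simp only: block_elems.simps set_map set_rev up Un_assoc)
qed

lemma selberg_carrier_eq:
  "selberg_carrier n r s m =
    X ` {1..n} \<union> \<Union>((\<lambda>b. set (block_elems r s m b)) ` block_index n)"
proof -
  have "{W i j k | i j k. i \<in> {1..n} \<and> j \<in> {1..n} \<and> i \<noteq> j \<and> k \<in> {1..m}} =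
    (\<Union>(i, j)\<in>index_pairs n. W i j ` {1..m}) \<union> (\<Union>(i, j)\<in>index_pairs n. W j i ` {1..m})"
    (is "?A = ?B")
  proof
    show "?A \<subseteq> ?B"
    proof
      fix e assume "e \<in> ?A"
      then obtain i j k where e: "e = W i j k" "i \<in> {1..n}" "j \<in> {1..n}" "i \<noteq> j" "k \<in> {1..m}"
        by auto
      have eW: "e \<in> W i j ` {1..m}" using e by simp
      have "(i, j) \<in> index_pairs n \<or> (j, i) \<in> index_pairs n"
        using e by (auto simp: index_pairs_def)
      then show "e \<in> ?B"
      proof
        assume "(i, j) \<in> index_pairs n"
        then show ?thesis
          by (intro UnI1 UN_I[of "(i, j)"]) (use eW in auto)
      next
        assume "(j, i) \<in> index_pairs n"
        then show ?thesis
          by (intro UnI2 UN_I[of "(j, i)"]) (use eW in auto)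
      qed
    qed
  qed (auto simp: index_pairs_def)
  moreover have "{Y i a | i a. i \<in> {1..n} \<and> a \<in> {1..r}} = (\<Union>i\<in>{1..n}. Y i ` {1..r})"
    "{Z i b | i b. i \<in> {1..n} \<and> b \<in> {1..s}} = (\<Union>i\<in>{1..n}. Z i ` {1..s})"
    "{X i | i. i \<in> {1..n}} = X ` {1..n}"
    by auto
  ultimately show ?thesis
    unfolding selberg_carrier_def Union_block_elems by (simp only: Un_ac)
qed

section \<open>The order of the letters in the word\<close>

text \<open>The first component numbers the five groups of letters. For \<open>W i j k\<close> with
  \<open>j < i\<close> the indices are swapped, since that group is also sorted with the smaller
  index first. Zeros pad the keys to equal length.\<close>

fun word_key :: "selberg_elem \<Rightarrow> nat \<times> nat \<times> nat \<times> nat" where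
  "word_key (W i j k) = (if i < j then (0, i, j, k) else (1, j, i, k))"
| "word_key (Y i a) = (2, i, a, 0)"
| "word_key (X i) = (3, i, 0, 0)"
| "word_key (Z i b) = (4, i, b, 0)"

definition word_less :: "selberg_elem \<Rightarrow> selberg_elem \<Rightarrow> bool" where
  "word_less a b \<longleftrightarrow>
    (word_key a, word_key b) \<in> less_than <*lex*> less_than <*lex*> less_than <*lex*> less_than"

lemma sorted_wrt_concat_map_upt:
  assumes "\<And>i. a \<le> i \<Longrightarrow> i < b \<Longrightarrow> sorted_wrt R (f i)"
    and "\<And>i j x y. a \<le> i \<Longrightarrow> i < j \<Longrightarrow> j < b \<Longrightarrow> x \<in> set (f i) \<Longrightarrow> y \<in> set (f j) \<Longrightarrow> R x y"
  shows "sorted_wrt R (concat (map f [a..<b]))"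
  using assms
proof (induction b)
  case (Suc b)
  then show ?case
    by (cases "a \<le> b") (auto simp: sorted_wrt_append)
qed simp

lemma sorted_selberg_word: "sorted_wrt word_less (selberg_word n r s m)"
  unfolding selberg_word_def
  by (auto simp: sorted_wrt_append word_less_def sorted_wrt_map
      simp del: upt_Suc intro!: sorted_wrt_concat_map_upt)

lemma set_selberg_word: "set (selberg_word n r s m) = selberg_carrier n r s m"
proof -
  have up: "set [a..<Suc b] = {a..b}" for a b by auto
  have "set (selberg_word n r s m) =
    (\<Union>(i, j)\<in>index_pairs n. W i j ` {1..m}) \<union> (\<Union>(i, j)\<in>index_pairs n. W j i ` {1..m}) \<union>
    (\<Union>i\<in>{1..n}. Y i ` {1..r}) \<union> X ` {1..n} \<union> (\<Union>i\<in>{1..n}. Z i ` {1..s})"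
  proof -
    have "index_pairs n = (SIGMA i:{1..n}. {Suc i..n})"
      by (auto simp: index_pairs_def)
    moreover have "(\<Union>(i, j)\<in>(SIGMA i:{1..n}. {Suc i..n}). f i j) = (\<Union>i\<in>{1..n}. \<Union>j\<in>{Suc i..n}. f i j)"
      for f :: "nat \<Rightarrow> nat \<Rightarrow> selberg_elem set"
      by auto
    ultimately show ?thesis
      unfolding selberg_word_def
      by (simp only: set_append set_concat set_map up image_image Un_assoc)
  qed
  then show ?thesis
    unfolding selberg_carrier_eq Union_block_elems by (simp only: Un_ac)
qed


section \<open>Fillings as inequalities between neighbours\<close>

text \<open>Exponents ascend along the block, so its range condition concerns only the last element.
  What remains are inequalities between neighbours, the form in which the generating relations of
  the poset appear.\<close>

lemma filling_UpW:
  assumes "m \<ge> 1"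
  shows "restrict k (set (block_elems r s m (UpW i j))) \<in> block_fillings r s m (UpW i j) x \<longleftrightarrow>
    k (W i j 1) < x (X i) \<and> (\<forall>l. 1 \<le> l \<and> l < m \<longrightarrow> k (W i j (Suc l)) \<le> k (W i j l)) \<and>
    x (X j) \<le> k (W i j m)"
proof -
  let ?cs = "map (W i j) (rev [1..<Suc m])"
  have ne: "?cs \<noteq> []" and hl: "hd ?cs = W i j m" "last ?cs = W i j 1"
    using assms by (auto simp: hd_map last_map hd_rev last_rev simp del: upt_Suc)
  have succ: "successively (\<lambda>a c. k a + 0 \<le> k c) ?cs \<longleftrightarrow>
      (\<forall>l. 1 \<le> l \<and> l < m \<longrightarrow> k (W i j (Suc l)) \<le> k (W i j l))"
    unfolding rev_map[symmetric] successively_rev successively_map_upt by auto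
  have img: "successively (\<lambda>a c. k a + 0 \<le> k c) ?cs \<Longrightarrow>
      k ` set ?cs \<subseteq> {..<x (X i)} \<longleftrightarrow> k (W i j 1) < x (X i)"
    using image_subset_lessThan_iff_last[of k 0 ?cs "x (X i)"] ne unfolding hl by blast
  show ?thesis
    unfolding block_elems.simps block_fillings.simps restrict_in_lattice_chains hl
    using img ne unfolding succ by blast
qed

lemma filling_DownW:
  assumes "m \<ge> 1"
  shows "restrict k (set (block_elems r s m (DownW i j))) \<in> block_fillings r s m (DownW i j) x \<longleftrightarrow>
    k (W j i m) < x (X i) \<and> (\<forall>l. 1 \<le> l \<and> l < m \<longrightarrow> k (W j i l) < k (W j i (Suc l))) \<and>
    x (X j) \<le> k (W j i 1)"
proof -
  let ?cs = "map (W j i) [1..<Suc m]"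
  have ne: "?cs \<noteq> []" and hl: "hd ?cs = W j i 1" "last ?cs = W j i m"
    using assms by (auto simp: hd_map last_map simp del: upt_Suc)
  have succ: "successively (\<lambda>a c. k a + 1 \<le> k c) ?cs \<longleftrightarrow>
      (\<forall>l. 1 \<le> l \<and> l < m \<longrightarrow> k (W j i l) < k (W j i (Suc l)))"
    unfolding successively_map_upt by auto
  have img: "successively (\<lambda>a c. k a + 1 \<le> k c) ?cs \<Longrightarrow>
      k ` set ?cs \<subseteq> {..<x (X i)} \<longleftrightarrow> k (W j i m) < x (X i)"
    using image_subset_lessThan_iff_last[of k 1 ?cs "x (X i)"] ne unfolding hl by blast
  show ?thesis
    unfolding block_elems.simps block_fillings.simps restrict_in_lattice_chains hl
    using img ne unfolding succ by blast
qed

lemma filling_ChainY: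
  "restrict k (set (block_elems r s m (ChainY i))) \<in> block_fillings r s m (ChainY i) x \<longleftrightarrow>
    (\<forall>l. 1 \<le> l \<and> l < r \<longrightarrow> k (Y i (Suc l)) \<le> k (Y i l)) \<and> (1 \<le> r \<longrightarrow> x (X i) \<le> k (Y i r))"
proof -
  let ?cs = "map (Y i) (rev [1..<Suc r])"
  have ne: "?cs \<noteq> [] \<longleftrightarrow> 1 \<le> r" and hl: "1 \<le> r \<Longrightarrow> hd ?cs = Y i r"
    by (auto simp: hd_map hd_rev simp del: upt_Suc)
  have succ: "successively (\<lambda>a c. k a + 0 \<le> k c) ?cs \<longleftrightarrow>
      (\<forall>l. 1 \<le> l \<and> l < r \<longrightarrow> k (Y i (Suc l)) \<le> k (Y i l))"
    unfolding rev_map[symmetric] successively_rev successively_map_upt by auto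
  show ?thesis
    unfolding block_elems.simps block_fillings.simps restrict_in_lattice_chains succ ne
    using hl by (metis subset_UNIV)
qed

lemma filling_ChainZ:
  "restrict k (set (block_elems r s m (ChainZ i))) \<in> block_fillings r s m (ChainZ i) x \<longleftrightarrow>
    (\<forall>l. 1 \<le> l \<and> l < s \<longrightarrow> k (Z i (Suc l)) \<le> k (Z i l)) \<and> (1 \<le> s \<longrightarrow> k (Z i 1) \<le> x (X i))"
proof -
  let ?cs = "map (Z i) (rev [1..<Suc s])"
  have ne: "?cs \<noteq> [] \<longleftrightarrow> 1 \<le> s" and hl: "1 \<le> s \<Longrightarrow> last ?cs = Z i 1"
    by (auto simp: last_map last_rev simp del: upt_Suc)
  have succ: "successively (\<lambda>a c. k a + 0 \<le> k c) ?cs \<longleftrightarrow>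
      (\<forall>l. 1 \<le> l \<and> l < s \<longrightarrow> k (Z i (Suc l)) \<le> k (Z i l))"
    unfolding rev_map[symmetric] successively_rev successively_map_upt by auto
  have img: "successively (\<lambda>a c. k a + 0 \<le> k c) ?cs \<Longrightarrow>
      k ` set ?cs \<subseteq> {..<Suc (x (X i))} \<longleftrightarrow> (1 \<le> s \<longrightarrow> k (Z i 1) \<le> x (X i))"
    using image_subset_lessThan_iff_last[of k 0 ?cs "Suc (x (X i))"] hl unfolding ne less_Suc_eq_le by metis
  show ?thesis
    unfolding block_elems.simps block_fillings.simps restrict_in_lattice_chains
    using img unfolding succ by (meson le0)
qed

lemma successively_Cons_map_upt:
  "successively R (a # map f [1..<Suc m]) \<longleftrightarrow>
    (1 \<le> m \<longrightarrow> R a (f 1)) \<and> (\<forall>l. 1 \<le> l \<and> l < m \<longrightarrow> R (f l) (f (Suc l)))"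
proof (cases "1 \<le> m")
  case True
  then have "map f [1..<Suc m] \<noteq> []" "hd (map f [1..<Suc m]) = f 1"
    by (auto simp: hd_map simp del: upt_Suc)
  then show ?thesis
    using True by (simp only: successively_Cons successively_map_upt) auto
qed auto

lemma successively_map_upt_append:
  "successively R (map f [1..<Suc m] @ b # xs) \<longleftrightarrow>
    (\<forall>l. 1 \<le> l \<and> l < m \<longrightarrow> R (f l) (f (Suc l))) \<and> (1 \<le> m \<longrightarrow> R (f m) b) \<and> successively R (b # xs)"
proof (cases "1 \<le> m")
  case True
  then have "map f [1..<Suc m] \<noteq> []" "last (map f [1..<Suc m]) = f m"
    by (auto simp: last_map simp del: upt_Suc)
  then show ?thesis
    using True by (simp only: successively_append_iff successively_map_upt list.sel) auto
qed auto

lemma successively_chain_map_upt: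
  assumes "1 \<le> m"
  shows "successively R (a # map f [1..<Suc m] @ [b]) \<longleftrightarrow>
    R a (f 1) \<and> (\<forall>l. 1 \<le> l \<and> l < m \<longrightarrow> R (f l) (f (Suc l))) \<and> R (f m) b"
proof -
  have "map f [1..<Suc m] \<noteq> []" "hd (map f [1..<Suc m]) = f 1"
    using assms by (auto simp: hd_map simp del: upt_Suc)
  then have "successively R (a # (map f [1..<Suc m] @ [b])) \<longleftrightarrow>
      R a (f 1) \<and> successively R (map f [1..<Suc m] @ [b])"
    unfolding successively_Cons by auto
  then show ?thesis
    using assms by (simp only: successively_map_upt_append) auto
qed

text \<open>As \<open>m >= 1\<close>, each generating relation joins two neighbours within a block
  or an end of a block to some \<open>X i\<close>. The conditions therefore split by blocks that
  share only the exponents of the \<open>X i\<close>.\<close>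

lemma compatible_selberg:
  assumes m: "m \<ge> 1"
    and \<omega>: "\<And>a b. a \<in> selberg_carrier n r s m \<Longrightarrow> b \<in> selberg_carrier n r s m \<Longrightarrow>
      word_less a b \<Longrightarrow> \<omega> a < \<omega> b"
    and inj: "inj_on \<omega> (selberg_carrier n r s m)"
  shows "compatible (selberg_carrier n r s m) (selberg_le n r s m) \<omega> =
    {k \<in> selberg_carrier n r s m \<rightarrow>\<^sub>E UNIV. \<forall>b\<in>block_index n.
       restrict k (set (block_elems r s m b)) \<in> block_fillings r s m b (restrict k (X ` {1..n}))}"
proof -
  define P where "P = selberg_carrier n r s m"
  define E where "E = (\<Union>c\<in>selberg_chains n r s m. set (zip c (tl c)))"
  have carrier: "X i \<in> P" "a \<in> {1..r} \<Longrightarrow> Y i a \<in> P" "b \<in> {1..s} \<Longrightarrow> Z i b \<in> P"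
    if "i \<in> {1..n}" for i a b
    using that by (auto simp: P_def selberg_carrier_def)
  have carrier_W: "W i j l \<in> P" "W j i l \<in> P" if "(i, j) \<in> index_pairs n" "l \<in> {1..m}" for i j l
    using that by (auto simp: P_def selberg_carrier_def index_pairs_def)
  have "set c \<subseteq> P" if "c \<in> selberg_chains n r s m" for c
    using that by (auto simp: selberg_chains_def P_def selberg_carrier_def index_pairs_def simp del: upt_Suc)
  moreover have "set (zip c (tl c)) \<subseteq> set c \<times> set c" for c :: "selberg_elem list"
    by (cases c) (auto dest: set_zip_leftD set_zip_rightD)
  ultimately have EP: "E \<subseteq> P \<times> P"
    unfolding E_def by blast
  have less: "\<omega> a < \<omega> b" "\<not> \<omega> b < \<omega> a" if "a \<in> P" "b \<in> P" "word_less a b" for a b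
    using \<omega>[of a b] that by (auto simp: P_def)
  have eq: "(\<forall>(a, b)\<in>E. k b \<le> k a \<and> (\<omega> b < \<omega> a \<longrightarrow> k b < k a)) \<longleftrightarrow>
    (\<forall>b\<in>block_index n. restrict k (set (block_elems r s m b)) \<in>
       block_fillings r s m b (restrict k (X ` {1..n})))" for k
  proof -
    \<comment> \<open>The condition imposed by one generating pair. It is weak if the smaller
      element comes first in the word and strict otherwise.\<close>
    define R where "R a b \<longleftrightarrow> k b \<le> k a \<and> (\<omega> b < \<omega> a \<longrightarrow> k b < k a)" for a b
    have R_weak: "R a b \<longleftrightarrow> k b \<le> k a" if "a \<in> P" "b \<in> P" "word_less a b" for a b
      using less[OF that] by (auto simp: R_def)
    have R_strict: "R b a \<longleftrightarrow> k a < k b" if "a \<in> P" "b \<in> P" "word_less a b" for a b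
      using less[OF that] by (auto simp: R_def)
    have up: "successively R ([X i] @ map (W i j) [1..<Suc m] @ [X j]) \<longleftrightarrow>
        restrict k (set (block_elems r s m (UpW i j))) \<in>
          block_fillings r s m (UpW i j) (restrict k (X ` {1..n}))"
      if ij: "(i, j) \<in> index_pairs n" for i j
    proof -
      have X: "X i \<in> P" "X j \<in> P" "restrict k (X ` {1..n}) (X i) = k (X i)"
          "restrict k (X ` {1..n}) (X j) = k (X j)" "i < j"
        using ij by (auto simp: index_pairs_def carrier)
      note W = carrier_W(1)[OF ij]
      have "R (X i) (W i j 1) \<longleftrightarrow> k (W i j 1) < k (X i)"
        using X W[of 1] m by (intro R_strict) (auto simp: word_less_def)
      moreover have "R (W i j m) (X j) \<longleftrightarrow> k (X j) \<le> k (W i j m)"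
        using X W[of m] m by (intro R_weak) (auto simp: word_less_def)
      moreover have "R (W i j l) (W i j (Suc l)) \<longleftrightarrow> k (W i j (Suc l)) \<le> k (W i j l)"
        if "1 \<le> l" "l < m" for l
        using X W[of l] W[of "Suc l"] that by (intro R_weak) (auto simp: word_less_def)
      ultimately show ?thesis
        unfolding filling_UpW[OF m] X(3,4) append_Cons append_Nil successively_chain_map_upt[OF m]
        by blast
    qed
    have down: "successively R ([X i] @ map (W j i) (rev [1..<Suc m]) @ [X j]) \<longleftrightarrow>
        restrict k (set (block_elems r s m (DownW i j))) \<in>
          block_fillings r s m (DownW i j) (restrict k (X ` {1..n}))"
      if ij: "(i, j) \<in> index_pairs n" for i j
    proof -
      have X: "X i \<in> P" "X j \<in> P" "restrict k (X ` {1..n}) (X i) = k (X i)"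
          "restrict k (X ` {1..n}) (X j) = k (X j)" "i < j"
        using ij by (auto simp: index_pairs_def carrier)
      note W = carrier_W(2)[OF ij]
      have "R (X i) (W j i m) \<longleftrightarrow> k (W j i m) < k (X i)"
        using X W[of m] m by (intro R_strict) (auto simp: word_less_def)
      moreover have "R (W j i 1) (X j) \<longleftrightarrow> k (X j) \<le> k (W j i 1)"
        using X W[of 1] m by (intro R_weak) (auto simp: word_less_def)
      moreover have "R (W j i (Suc l)) (W j i l) \<longleftrightarrow> k (W j i l) < k (W j i (Suc l))"
        if "1 \<le> l" "l < m" for l
        using X W[of l] W[of "Suc l"] that by (intro R_strict) (auto simp: word_less_def)
      \<comment> \<open>The poset chain is reversed so that the superscripts ascend, as the lemma on
        chains over an interval of indices expects.\<close>
      moreover have rev_eq: "[X i] @ map (W j i) (rev [1..<Suc m]) @ [X j] =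
          rev (X j # map (W j i) [1..<Suc m] @ [X i])"
        by (simp add: rev_map del: upt_Suc)
      ultimately show ?thesis
        unfolding filling_DownW[OF m] X(3,4) rev_eq successively_rev successively_chain_map_upt[OF m]
        by blast
    qed
    have yz: "successively R (map (Y i) [1..<Suc r] @ [X i] @ map (Z i) [1..<Suc s]) \<longleftrightarrow>
        restrict k (set (block_elems r s m (ChainY i))) \<in>
          block_fillings r s m (ChainY i) (restrict k (X ` {1..n})) \<and>
        restrict k (set (block_elems r s m (ChainZ i))) \<in>
          block_fillings r s m (ChainZ i) (restrict k (X ` {1..n}))"
      if i: "i \<in> {1..n}" for i
    proof -
      have X: "X i \<in> P" "restrict k (X ` {1..n}) (X i) = k (X i)"
        using i by (auto simp: carrier)
      note Y = carrier(2)[OF i] and Z = carrier(3)[OF i]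
      have "R (Y i r) (X i) \<longleftrightarrow> k (X i) \<le> k (Y i r)" if "1 \<le> r"
        using X Y[of r] that by (intro R_weak) (auto simp: word_less_def)
      moreover have "R (Y i l) (Y i (Suc l)) \<longleftrightarrow> k (Y i (Suc l)) \<le> k (Y i l)"
        if "1 \<le> l" "l < r" for l
        using Y[of l] Y[of "Suc l"] that by (intro R_weak) (auto simp: word_less_def)
      moreover have "R (X i) (Z i 1) \<longleftrightarrow> k (Z i 1) \<le> k (X i)" if "1 \<le> s"
        using X Z[of 1] that by (intro R_weak) (auto simp: word_less_def)
      moreover have "R (Z i l) (Z i (Suc l)) \<longleftrightarrow> k (Z i (Suc l)) \<le> k (Z i l)"
        if "1 \<le> l" "l < s" for l
        using Z[of l] Z[of "Suc l"] that by (intro R_weak) (auto simp: word_less_def)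
      moreover have "successively R (map (Y i) [1..<Suc r] @ [X i] @ map (Z i) [1..<Suc s]) \<longleftrightarrow>
          (\<forall>l. 1 \<le> l \<and> l < r \<longrightarrow> R (Y i l) (Y i (Suc l))) \<and> (1 \<le> r \<longrightarrow> R (Y i r) (X i)) \<and>
          (1 \<le> s \<longrightarrow> R (X i) (Z i 1)) \<and> (\<forall>l. 1 \<le> l \<and> l < s \<longrightarrow> R (Z i l) (Z i (Suc l)))"
        unfolding append_Cons append_Nil successively_map_upt_append successively_Cons_map_upt
        by blast
      ultimately show ?thesis
        unfolding filling_ChainY filling_ChainZ X(2) by blast
    qed
    have "(\<forall>(a, b)\<in>E. R a b) \<longleftrightarrow> (\<forall>c\<in>selberg_chains n r s m. successively R c)"
      unfolding E_def successively_iff_zip_tl by blast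
    also have "\<dots> \<longleftrightarrow>
        (\<forall>(i, j)\<in>index_pairs n. successively R ([X i] @ map (W i j) [1..<Suc m] @ [X j])) \<and>
        (\<forall>(i, j)\<in>index_pairs n. successively R ([X i] @ map (W j i) (rev [1..<Suc m]) @ [X j])) \<and>
        (\<forall>i\<in>{1..n}. successively R (map (Y i) [1..<Suc r] @ [X i] @ map (Z i) [1..<Suc s]))"
      unfolding selberg_chains_def by blast
    also have "\<dots> \<longleftrightarrow> (\<forall>b\<in>block_index n. restrict k (set (block_elems r s m b)) \<in>
       block_fillings r s m b (restrict k (X ` {1..n})))"
      unfolding ball_block_index using up down yz by blast
    finally show ?thesis by (simp only: R_def)
  qed
  have "compatible P (E\<^sup>*) \<omega> =
    {k \<in> P \<rightarrow>\<^sub>E UNIV. \<forall>(a, b)\<in>E. k b \<le> k a \<and> (\<omega> b < \<omega> a \<longrightarrow> k b < k a)}"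
    using inj by (intro compatible_rtrancl EP) (simp add: P_def)
  then show ?thesis
    unfolding eq by (simp only: P_def E_def selberg_le_def)
qed

section \<open>Comparison with the Selberg integrand\<close>

lemma card_index_pairs: "card (index_pairs n) = n choose 2"
proof (induction n)
  case 0
  have "index_pairs 0 = {}" by (auto simp: index_pairs_def)
  then show ?case by simp
next
  case (Suc n)
  have "index_pairs (Suc n) = index_pairs n \<union> (\<lambda>i. (i, Suc n)) ` {1..n}"
    by (auto simp: index_pairs_def le_Suc_eq)
  moreover have "index_pairs n \<inter> (\<lambda>i. (i, Suc n)) ` {1..n} = {}"
    by (auto simp: index_pairs_def)
  ultimately have "card (index_pairs (Suc n)) = card (index_pairs n) + card ((\<lambda>i. (i, Suc n)) ` {1..n})"
    by (simp add: card_Un_disjoint)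
  also have "card ((\<lambda>i. (i, Suc n)) ` {1..n}) = n"
    by (subst card_image) (auto simp: inj_on_def)
  finally show ?case
    using Suc by (simp add: numeral_2_eq_2)
qed

text \<open>The exponents \<open>l - p\<close> run from \<open>-p\<close> to \<open>p\<close>. A
  negative one is cleared by \<open>q ^ l * (y - q powi (-l) * a) = q ^ l * y - a\<close>, and the
  total \<open>1 + ... + p\<close> is \<open>Suc p choose 2\<close>. The extra \<open>y - a\<close>
  supplies the second factor with exponent 0. Each induction step adds one factor at both
  ends.\<close>

lemma prod_balanced_q_powers:
  fixes q a y :: real
  assumes "q > 0"
  shows "q ^ (Suc p choose 2) * (\<Prod>l=0..2 * p. y - q powi (int l - int p) * a) * (y - a) =
    (\<Prod>l<Suc p. y - q ^ l * a) * (\<Prod>l<Suc p. q ^ l * y - a)"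
proof (induction p)
  case 0
  show ?case by (simp add: numeral_2_eq_2)
next
  case (Suc p)
  define Q where "Q p = (\<Prod>l=0..2 * p. y - q powi (int l - int p) * a)" for p
  have "Q (Suc p) = (\<Prod>l=0..Suc (Suc (2 * p)). y - q powi (int l - int (Suc p)) * a)"
    by (simp add: Q_def)
  also have "\<dots> = (y - q powi (- int (Suc p)) * a) *
      (\<Prod>l=0..2 * p. y - q powi (int (Suc l) - int (Suc p)) * a) *
      (y - q powi (int (Suc (Suc (2 * p))) - int (Suc p)) * a)"
    by (subst prod.atLeast0_atMost_Suc_shift, subst prod.atLeast0_atMost_Suc) (simp add: mult_ac)
  also have "(\<Prod>l=0..2 * p. y - q powi (int (Suc l) - int (Suc p)) * a) = Q p"
    by (simp add: Q_def)
  also have "int (Suc (Suc (2 * p))) - int (Suc p) = int (Suc p)"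
    by simp
  finally have Q: "Q (Suc p) =
      (y - q powi (- int (Suc p)) * a) * Q p * (y - q ^ Suc p * a)"
    by (simp only: power_int_of_nat)
  have "q ^ Suc p * (y - q powi (- int (Suc p)) * a) = q ^ Suc p * y - a"
    using assms by (simp add: power_int_minus field_simps del: power_Suc of_nat_Suc)
  moreover have "Suc (Suc p) choose 2 = (Suc p choose 2) + Suc p"
    by (simp add: numeral_2_eq_2)
  ultimately have "q ^ (Suc (Suc p) choose 2) * Q (Suc p) * (y - a) =
      (q ^ (Suc p choose 2) * Q p * (y - a)) * (y - q ^ Suc p * a) * (q ^ Suc p * y - a)"
    unfolding Q by (simp only: power_add) (simp add: mult_ac)
  also have "q ^ (Suc p choose 2) * Q p * (y - a) =
      (\<Prod>l<Suc p. y - q ^ l * a) * (\<Prod>l<Suc p. q ^ l * y - a)"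
    unfolding Q_def by (rule Suc.IH)
  finally show ?case
    unfolding Q_def by (simp add: mult_ac)
qed

lemma pair_factor:
  fixes q :: real
  assumes q: "0 < q" "q < 1" and m: "m \<ge> 1" and ab: "b \<le> a"
    and cs: "distinct cs" "length cs = m" and ds: "distinct ds" "length ds = m"
  shows "(\<Prod>l=0..2 * m - 2. q ^ b - q powi (1 - int m + int l) * q ^ a) * (q ^ b - q ^ a) =
    q powi (- int (m choose 2)) * q_fact q m ^ 2 *
    (chain_sum q 0 {..<a} b cs * chain_sum q 1 {..<a} b ds)"
proof -
  obtain p where p: "m = Suc p" using m by (cases m) auto
  have "q ^ (m choose 2) *
      ((\<Prod>l=0..2 * m - 2. q ^ b - q powi (1 - int m + int l) * q ^ a) * (q ^ b - q ^ a)) =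
    (\<Prod>l<m. q ^ b - q ^ l * q ^ a) * (\<Prod>l<m. q ^ l * q ^ b - q ^ a)"
    using prod_balanced_q_powers[OF q(1), of p "q ^ b" "q ^ a"] by (simp add: p mult.assoc)
  also have "\<dots> = (q_fact q m * chain_sum q 0 {..<a} b cs) * (q_fact q m * chain_sum q 1 {..<a} b ds)"
    using chain_sum_weak[OF q cs(1) ab] chain_sum_strict[OF q ds(1) ab] cs ds by simp
  finally show ?thesis
    using q by (simp add: power_int_minus power2_eq_square field_simps)
qed

text \<open>The elements above \<open>X i\<close> have exponents from 0 to \<open>a\<close>. The
  exclusive bound \<open>Suc a\<close> of this chain is the origin of the argument
  \<open>q * q ^ a\<close> of the shifted factorial.\<close>

lemma index_factor:
  fixes q :: real
  assumes q: "0 < q" "q < 1"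
    and cs: "distinct cs" "length cs = r" and ds: "distinct ds" "length ds = s"
  shows "(q ^ a) ^ r * q_pochhammer (q * q ^ a) q s =
    q_fact q r * q_fact q s * (chain_sum q 0 UNIV a cs * chain_sum q 0 {..<Suc a} 0 ds)"
proof -
  have "q_fact q r * chain_sum q 0 UNIV a cs = (q ^ a) ^ r"
    using chain_sum_unbounded[OF q cs(1), of a] cs by simp
  moreover have "q_fact q s * chain_sum q 0 {..<Suc a} 0 ds = q_pochhammer (q * q ^ a) q s"
    using chain_sum_weak[OF q ds(1), of 0 "Suc a"] ds by (simp add: q_pochhammer_def mult_ac)
  ultimately show ?thesis by (metis mult.assoc mult.left_commute)
qed

definition selberg_integrand :: "real \<Rightarrow> nat \<Rightarrow> nat \<Rightarrow> nat \<Rightarrow> nat \<Rightarrow> (nat \<Rightarrow> real) \<Rightarrow> real" where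
  "selberg_integrand q n r s m x =
     (\<Prod>i=1..n. x i ^ r * q_pochhammer (q * x i) q s) *
     (\<Prod>(i, j)\<in>index_pairs n. \<Prod>l=0..2 * m - 2. x j - q powi (1 - int m + int l) * x i) *
     Delta_bar n x"

text \<open>Needed only for convergence, so the bound is crude. It is not 1 because negative powers
  of \<open>q\<close> exceed 1.\<close>

lemma selberg_integrand_bounded:
  assumes q: "0 < q" "q < 1" and u: "\<And>i. i \<in> {1..n} \<Longrightarrow> 0 < u i \<and> u i \<le> 1"
  shows "\<bar>selberg_integrand q n r s m u\<bar> \<le>
    (\<Prod>(i, j)\<in>index_pairs n. \<Prod>l=0..2 * m - 2. 1 + q powi (1 - int m + int l))"
proof -
  have pair: "0 < u i \<and> u i \<le> 1 \<and> 0 < u j \<and> u j \<le> 1" if "(i, j) \<in> index_pairs n" for i j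
    using that u[of i] u[of j] by (auto simp: index_pairs_def)
  have "\<bar>\<Prod>i=1..n. u i ^ r * q_pochhammer (q * u i) q s\<bar> \<le> 1"
    unfolding abs_prod
  proof (intro prod_le_1 conjI)
    fix i assume i: "i \<in> {1..n}"
    have "\<bar>q_pochhammer (q * u i) q s\<bar> \<le> 1"
      unfolding q_pochhammer_def abs_prod
    proof (intro prod_le_1 conjI)
      fix l
      have "0 \<le> q * u i * q ^ l" "q * u i * q ^ l \<le> 1"
        using u[OF i] q by (auto intro!: mult_le_one power_le_one)
      then show "\<bar>1 - q * u i * q ^ l\<bar> \<le> 1" by simp
    qed auto
    then show "\<bar>u i ^ r * q_pochhammer (q * u i) q s\<bar> \<le> 1"
      using u[OF i] by (auto simp: abs_mult intro!: mult_le_one power_le_one)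
  qed auto
  moreover have "\<bar>\<Prod>(i, j)\<in>index_pairs n. \<Prod>l=0..2 * m - 2. u j - q powi (1 - int m + int l) * u i\<bar> \<le>
      (\<Prod>(i, j)\<in>index_pairs n. \<Prod>l=0..2 * m - 2. 1 + q powi (1 - int m + int l))"
    unfolding abs_prod
  proof (rule prod_mono, clarify, unfold abs_prod, intro conjI prod_nonneg prod_mono)
    fix i j l assume ij: "(i, j) \<in> index_pairs n"
    have "0 \<le> q powi (1 - int m + int l)" using q by simp
    then have "0 \<le> q powi (1 - int m + int l) * u i"
      "q powi (1 - int m + int l) * u i \<le> q powi (1 - int m + int l) * 1"
      using pair[OF ij] by (intro mult_nonneg_nonneg mult_left_mono; simp)+
    then show "\<bar>u j - q powi (1 - int m + int l) * u i\<bar> \<le> 1 + q powi (1 - int m + int l)"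
      using pair[OF ij] by linarith
  qed auto
  moreover have "\<bar>Delta_bar n u\<bar> \<le> 1"
    unfolding Delta_bar_def abs_prod
    by (intro prod_le_1) (use pair in \<open>force simp: abs_le_iff\<close>)
  moreover have "0 \<le> (\<Prod>(i, j)\<in>index_pairs n. \<Prod>l=0..2 * m - 2. 1 + q powi (1 - int m + int l))"
    using q by (intro prod_nonneg) (auto intro!: prod_nonneg add_nonneg_nonneg)
  ultimately have "\<bar>\<Prod>i=1..n. u i ^ r * q_pochhammer (q * u i) q s\<bar> *
      \<bar>\<Prod>(i, j)\<in>index_pairs n. \<Prod>l=0..2 * m - 2. u j - q powi (1 - int m + int l) * u i\<bar> *
      \<bar>Delta_bar n u\<bar> \<le>
      1 * (\<Prod>(i, j)\<in>index_pairs n. \<Prod>l=0..2 * m - 2. 1 + q powi (1 - int m + int l)) * 1"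
    by (intro mult_mono) (auto intro!: mult_nonneg_nonneg)
  then show ?thesis
    by (simp add: selberg_integrand_def abs_mult)
qed

definition chain_product :: "real \<Rightarrow> nat \<Rightarrow> nat \<Rightarrow> nat \<Rightarrow> nat \<Rightarrow> (nat \<Rightarrow> nat) \<Rightarrow> real" where
  "chain_product q n r s m y =
    (\<Prod>(i, j)\<in>index_pairs n.
       chain_sum q 0 {..<y i} (y j) (block_elems r s m (UpW i j)) *
       chain_sum q 1 {..<y i} (y j) (block_elems r s m (DownW i j))) *
    (\<Prod>i=1..n.
       chain_sum q 0 UNIV (y i) (block_elems r s m (ChainY i)) *
       chain_sum q 0 {..<Suc (y i)} 0 (block_elems r s m (ChainZ i)))"

lemma distinct_block_elems: "distinct (block_elems r s m b)"
  by (cases b) (auto simp: distinct_map inj_on_def simp del: upt_Suc)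

text \<open>The theorem holds summand by summand. The order of the exponents is required by the
  closed forms of the chain sums between \<open>y j\<close> and \<open>y i\<close>.\<close>

lemma selberg_integrand_lattice:
  fixes q :: real
  assumes q: "0 < q" "q < 1" and m: "m \<ge> 1"
    and y: "\<And>i j. (i, j) \<in> index_pairs n \<Longrightarrow> y j \<le> y i"
  shows "selberg_integrand q n r s m (lattice_point q {1..n} y) =
    q powi (- int ((m choose 2) * (n choose 2))) *
    q_fact q r ^ n * q_fact q s ^ n * q_fact q m ^ (2 * (n choose 2)) * chain_product q n r s m y"
proof -
  let ?x = "lattice_point q {1..n} y"
  have x: "?x i = q ^ y i" if "i \<in> {1..n}" for i
    using that by (simp add: lattice_point_def)
  have "(\<Prod>(i, j)\<in>index_pairs n. \<Prod>l=0..2 * m - 2. ?x j - q powi (1 - int m + int l) * ?x i) *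
      Delta_bar n ?x =
    (\<Prod>(i, j)\<in>index_pairs n.
      q powi (- int (m choose 2)) * q_fact q m ^ 2 *
      (chain_sum q 0 {..<y i} (y j) (block_elems r s m (UpW i j)) *
       chain_sum q 1 {..<y i} (y j) (block_elems r s m (DownW i j))))"
    unfolding Delta_bar_def prod.distrib[symmetric]
  proof (rule prod.cong)
    fix p assume "p \<in> index_pairs n"
    then obtain i j where p: "p = (i, j)" and ij: "(i, j) \<in> index_pairs n"
      by (cases p) auto
    then have mem: "i \<in> {1..n}" "j \<in> {1..n}"
      by (auto simp: index_pairs_def)
    show "(case p of (i, j) \<Rightarrow>
          \<Prod>l=0..2 * m - 2. ?x j - q powi (1 - int m + int l) * ?x i) *
        (case p of (i, j) \<Rightarrow> ?x j - ?x i) =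
      (case p of (i, j) \<Rightarrow> q powi (- int (m choose 2)) * q_fact q m ^ 2 *
        (chain_sum q 0 {..<y i} (y j) (block_elems r s m (UpW i j)) *
         chain_sum q 1 {..<y i} (y j) (block_elems r s m (DownW i j))))"
      unfolding p prod.case x[OF mem(1)] x[OF mem(2)]
      by (rule pair_factor[OF q m y[OF ij] distinct_block_elems _ distinct_block_elems]) simp_all
  qed simp
  also have "\<dots> = (q powi (- int (m choose 2)) * q_fact q m ^ 2) ^ (n choose 2) *
    (\<Prod>(i, j)\<in>index_pairs n.
      chain_sum q 0 {..<y i} (y j) (block_elems r s m (UpW i j)) *
      chain_sum q 1 {..<y i} (y j) (block_elems r s m (DownW i j)))"
    unfolding case_prod_beta prod.distrib by (simp add: card_index_pairs power_mult_distrib)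
  also have "(q powi (- int (m choose 2)) * q_fact q m ^ 2) ^ (n choose 2) =
      q powi (- int ((m choose 2) * (n choose 2))) * q_fact q m ^ (2 * (n choose 2))"
    by (simp add: power_mult_distrib power_int_minus power_mult power_inverse del: of_nat_mult)
  finally have pairs: "(\<Prod>(i, j)\<in>index_pairs n. \<Prod>l=0..2 * m - 2. ?x j - q powi (1 - int m + int l) * ?x i) *
      Delta_bar n ?x =
    q powi (- int ((m choose 2) * (n choose 2))) * q_fact q m ^ (2 * (n choose 2)) *
    (\<Prod>(i, j)\<in>index_pairs n.
      chain_sum q 0 {..<y i} (y j) (block_elems r s m (UpW i j)) *
      chain_sum q 1 {..<y i} (y j) (block_elems r s m (DownW i j)))" .
  have "(\<Prod>i=1..n. ?x i ^ r * q_pochhammer (q * ?x i) q s) =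
    (\<Prod>i=1..n. (q_fact q r * q_fact q s) *
      (chain_sum q 0 UNIV (y i) (block_elems r s m (ChainY i)) *
       chain_sum q 0 {..<Suc (y i)} 0 (block_elems r s m (ChainZ i))))"
  proof (rule prod.cong)
    fix i assume "i \<in> {1..n}"
    then have "?x i = q ^ y i" by (rule x)
    then show "?x i ^ r * q_pochhammer (q * ?x i) q s = (q_fact q r * q_fact q s) *
      (chain_sum q 0 UNIV (y i) (block_elems r s m (ChainY i)) *
       chain_sum q 0 {..<Suc (y i)} 0 (block_elems r s m (ChainZ i)))"
      using index_factor[OF q distinct_block_elems[of r s m "ChainY i"] _
          distinct_block_elems[of r s m "ChainZ i"]] by simp
  qed simp
  also have "\<dots> = q_fact q r ^ n * q_fact q s ^ n *
    (\<Prod>i=1..n. chain_sum q 0 UNIV (y i) (block_elems r s m (ChainY i)) *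
       chain_sum q 0 {..<Suc (y i)} 0 (block_elems r s m (ChainZ i)))"
    by (simp add: prod.distrib power_mult_distrib)
  finally show ?thesis
    unfolding selberg_integrand_def chain_product_def mult.assoc pairs by (simp add: mult_ac)
qed

text \<open>Lets the sum over ordered exponents be extended to all exponents: for a misordered pair
  the block between \<open>y j\<close> and \<open>y i\<close> has no filling.\<close>

lemma chain_product_eq_0:
  assumes "m \<ge> 1" "(i, j) \<in> index_pairs n" "y i < y j"
  shows "chain_product q n r s m y = 0"
proof -
  have "chain_sum q 0 {..<y i} (y j) (block_elems r s m (UpW i j)) = 0"
    using assms by (intro chain_sum_eq_0) auto
  then have "(\<Prod>(i, j)\<in>index_pairs n.
       chain_sum q 0 {..<y i} (y j) (block_elems r s m (UpW i j)) *
       chain_sum q 1 {..<y i} (y j) (block_elems r s m (DownW i j))) = 0"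
    using assms(2) by (intro prod_zero bexI[of _ "(i, j)"]) auto
  then show ?thesis by (simp add: chain_product_def)
qed

section \<open>Assembling both integrals\<close>

lemma word_rank_exists:
  obtains \<omega> :: "selberg_elem \<Rightarrow> nat" where
    "\<And>a b. a \<in> selberg_carrier n r s m \<Longrightarrow> b \<in> selberg_carrier n r s m \<Longrightarrow> word_less a b \<Longrightarrow> \<omega> a < \<omega> b"
    "inj_on \<omega> (selberg_carrier n r s m)"
    "sorted_wrt (\<lambda>a b. \<omega> a < \<omega> b) (selberg_word n r s m)"
proof
  let ?P = "selberg_carrier n r s m"
  \<comment> \<open>The number of letters preceding \<open>b\<close>, which turns the order on
    four-tuples into natural-number ranks.\<close>
  define \<omega> where "\<omega> b = card {a \<in> ?P. word_less a b}" for b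
  have fin: "finite ?P"
    by (simp flip: set_selberg_word)
  show less: "\<omega> a < \<omega> b" if "a \<in> ?P" "b \<in> ?P" "word_less a b" for a b
  proof -
    have "trans (less_than <*lex*> less_than <*lex*> less_than <*lex*> less_than)"
      by (intro trans_lex_prod trans_less_than)
    then have "word_less c b" if "word_less c a" for c
      using that \<open>word_less a b\<close> unfolding word_less_def by (rule transD)
    moreover have "\<not> word_less a a"
      by (cases "word_key a" rule: prod_cases4) (simp add: word_less_def)
    ultimately have "{c \<in> ?P. word_less c a} \<subset> {c \<in> ?P. word_less c b}"
      using that by blast
    then show ?thesis
      unfolding \<omega>_def using fin by (intro psubset_card_mono) auto
  qed
  show "inj_on \<omega> ?P"
  proof (rule inj_onI, rule ccontr)
    fix a b assume ab: "a \<in> ?P" "b \<in> ?P" "\<omega> a = \<omega> b" "a \<noteq> b"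
    then obtain i j where "i < length (selberg_word n r s m)" "selberg_word n r s m ! i = a"
      "j < length (selberg_word n r s m)" "selberg_word n r s m ! j = b"
      unfolding set_selberg_word[symmetric] in_set_conv_nth by blast
    \<comment> \<open>Distinct letters occupy distinct positions of a sorted word, hence are
      comparable.\<close>
    then have "word_less a b \<or> word_less b a"
      using sorted_wrt_nth_less[OF sorted_selberg_word] ab(4) by (metis linorder_neqE_nat)
    then show False
      using less ab by force
  qed
  show "sorted_wrt (\<lambda>a b. \<omega> a < \<omega> b) (selberg_word n r s m)"
    using sorted_selberg_word by (rule sorted_wrt_mono_rel[rotated]) (auto simp: set_selberg_word less)
qed

lemma disjoint_block_elems:
  "disjoint_family_on (\<lambda>b. set (block_elems r s m b)) (block_index n)"
  unfolding disjoint_family_on_def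
proof (intro ballI impI)
  fix b b' assume "b \<in> block_index n" "b' \<in> block_index n" "b \<noteq> b'"
  then show "set (block_elems r s m b) \<inter> set (block_elems r s m b') = {}"
    by (cases b; cases b') (auto simp: block_index_def index_pairs_def)
qed

lemma multi_q_integral_selberg:
  fixes q :: real
  assumes q: "0 < q" "q < 1" and m: "m \<ge> 1"
  shows "multi_q_integral q (order_polytope (selberg_carrier n r s m) (selberg_le n r s m))
      (\<lambda>_. 1) (selberg_word n r s m) =
    infsum (\<lambda>y. chain_product q n r s m y * lattice_weight q {1..n} y) ({1..n} \<rightarrow>\<^sub>E UNIV)"
proof -
  let ?P = "selberg_carrier n r s m" and ?B = "\<lambda>b. set (block_elems r s m b)" and ?D = "X ` {1..n}"
  obtain \<omega> :: "selberg_elem \<Rightarrow> nat" where \<omega>: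
    "\<And>a b. a \<in> ?P \<Longrightarrow> b \<in> ?P \<Longrightarrow> word_less a b \<Longrightarrow> \<omega> a < \<omega> b"
    "inj_on \<omega> ?P" "sorted_wrt (\<lambda>a b. \<omega> a < \<omega> b) (selberg_word n r s m)"
    by (rule word_rank_exists) blast
  have "multi_q_integral q (order_polytope ?P (selberg_le n r s m)) (\<lambda>_. 1) (selberg_word n r s m) =
    infsum (lattice_weight q ?P) (compatible ?P (selberg_le n r s m) \<omega>)"
    using multi_q_integral_order_polytope[OF q _ _ _ \<omega>(3), of "selberg_le n r s m" "\<lambda>_. 1" 1]
    by (simp add: set_selberg_word selberg_le_def trans_rtrancl)
  also have "\<dots> = infsum (\<lambda>k. 1 * lattice_weight q (?D \<union> \<Union>(?B ` block_index n)) k)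
      {k \<in> (?D \<union> \<Union>(?B ` block_index n)) \<rightarrow>\<^sub>E UNIV.
        \<forall>b\<in>block_index n. restrict k (?B b) \<in> block_fillings r s m b (restrict k ?D)}"
    using compatible_selberg[OF m \<omega>(1,2)] by (simp only: mult_1 selberg_carrier_eq)
  also have "\<dots> = infsum (\<lambda>x. 1 * (\<Prod>b\<in>block_index n.
      infsum (lattice_weight q (?B b)) (block_fillings r s m b x)) * lattice_weight q ?D x) (?D \<rightarrow>\<^sub>E UNIV)"
  proof (rule infsum_lattice_weight_blocks[OF q, where M = 1])
    show "?B b \<inter> ?D = {}" if "b \<in> block_index n" for b
      by (cases b) auto
    show "block_fillings r s m b x \<subseteq> ?B b \<rightarrow>\<^sub>E UNIV" for b x
      by (cases b) (auto simp: lattice_chains_def simp del: block_elems.simps)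
  qed (auto simp: disjoint_block_elems)
  also have "\<dots> = infsum (\<lambda>x. chain_product q n r s m (\<lambda>i\<in>{1..n}. x (X i)) *
      lattice_weight q {1..n} (\<lambda>i\<in>{1..n}. x (X i))) (?D \<rightarrow>\<^sub>E UNIV)"
  proof (rule infsum_cong)
    fix x :: "selberg_elem \<Rightarrow> nat"
    let ?y = "\<lambda>i\<in>{1..n}. x (X i)"
    have "(\<Prod>b\<in>block_index n. infsum (lattice_weight q (?B b)) (block_fillings r s m b x)) =
        chain_product q n r s m ?y"
      unfolding prod_block_index chain_product_def
      by (intro arg_cong2[where f = "(*)"] prod.cong)
        (auto simp: chain_sum_def index_pairs_def simp del: block_elems.simps)
    moreover have "lattice_weight q ?D x = lattice_weight q {1..n} ?y"
      by (simp add: lattice_weight_def prod.reindex inj_on_def)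
    ultimately show "1 * (\<Prod>b\<in>block_index n. infsum (lattice_weight q (?B b)) (block_fillings r s m b x)) *
        lattice_weight q ?D x = chain_product q n r s m ?y * lattice_weight q {1..n} ?y"
      by simp
  qed
  \<comment> \<open>Passes from functions on the elements \<open>X i\<close> to functions on the
    indices, as used for the simplex.\<close>
  also have "\<dots> = infsum (\<lambda>y. chain_product q n r s m y * lattice_weight q {1..n} y) ({1..n} \<rightarrow>\<^sub>E UNIV)"
  proof -
    have "bij_betw (\<lambda>x. \<lambda>i\<in>{1..n}. x (X i)) (?D \<rightarrow>\<^sub>E UNIV) ({1..n} \<rightarrow>\<^sub>E (UNIV :: nat set))"
      by (rule bij_betwI[where g = "\<lambda>y. \<lambda>e\<in>?D. y (case e of X i \<Rightarrow> i)"])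
        (auto simp: PiE_iff extensional_def fun_eq_iff restrict_def)
    from infsum_reindex_bij_betw[OF this] show ?thesis .
  qed
  finally show ?thesis .
qed

lemma multi_q_integral_selberg_integrand:
  fixes q :: real
  assumes q: "0 < q" "q < 1"
  shows "multi_q_integral q (ordered_simplex n) (selberg_integrand q n r s m) [1..<Suc n] =
    infsum (\<lambda>y. selberg_integrand q n r s m (lattice_point q {1..n} y) * lattice_weight q {1..n} y)
      {y \<in> {1..n} \<rightarrow>\<^sub>E UNIV. \<forall>(i, j)\<in>index_pairs n. y j \<le> y i}"
proof -
  have set: "set [1..<Suc n] = {1..n}" by auto
  have simplex: "ordered_simplex n = order_polytope {1..n} {(a, b). a \<le> b}"
    by (auto simp: ordered_simplex_def order_polytope_def monotone_on_def)
  have "compatible {1..n} {(a, b). a \<le> b} (\<lambda>i. i) =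
      {y \<in> {1..n} \<rightarrow>\<^sub>E UNIV. \<forall>(i, j)\<in>index_pairs n. y j \<le> y i}"
    by (auto simp: compatible_def index_pairs_def)
  moreover have "multi_q_integral q (order_polytope (set [1..<Suc n]) {(a, b). a \<le> b})
      (selberg_integrand q n r s m) [1..<Suc n] =
    infsum (\<lambda>y. selberg_integrand q n r s m (lattice_point q (set [1..<Suc n]) y) *
      lattice_weight q (set [1..<Suc n]) y) (compatible (set [1..<Suc n]) {(a, b). a \<le> b} (\<lambda>i. i))"
  proof (rule multi_q_integral_order_polytope[OF q])
    show "trans {(a :: nat, b). a \<le> b}"
      by (auto simp: trans_def)
    show "\<bar>selberg_integrand q n r s m u\<bar> \<le>
        (\<Prod>(i, j)\<in>index_pairs n. \<Prod>l=0..2 * m - 2. 1 + q powi (1 - int m + int l))"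
      if "\<And>v. v \<in> set [1..<Suc n] \<Longrightarrow> 0 < u v \<and> u v \<le> 1" for u
      using that unfolding set by (intro selberg_integrand_bounded[OF q]) blast
    show "sorted_wrt (\<lambda>a b. a < b) [1..<Suc n]"
      by (rule sorted_wrt_upt)
  qed auto
  ultimately show ?thesis
    unfolding set simplex by simp
qed

theorem theorem7p5:
  fixes q :: real and n r s m :: nat
  assumes "0 < q" and "q < 1" and "n \<ge> 1" and "m \<ge> 1"
  shows "multi_q_integral q (ordered_simplex n)
           (\<lambda>x. (\<Prod>i=1..n. x i ^ r * q_pochhammer (q * x i) q s) *
                (\<Prod>(i, j)\<in>index_pairs n.
                   \<Prod>l=0..2 * m - 2. x j - q powi (1 - int m + int l) * x i) *
                Delta_bar n x)
           [1..<Suc n]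
         = q powi (- int ((m choose 2) * (n choose 2))) *
           q_fact q r ^ n * q_fact q s ^ n * q_fact q m ^ (2 * (n choose 2)) *
           multi_q_integral q
             (order_polytope (selberg_carrier n r s m) (selberg_le n r s m))
             (\<lambda>_. 1) (selberg_word n r s m)"
proof -
  note q = assms(1,2) and m = assms(4)
  let ?c = "q powi (- int ((m choose 2) * (n choose 2))) *
    q_fact q r ^ n * q_fact q s ^ n * q_fact q m ^ (2 * (n choose 2))"
  have "multi_q_integral q (ordered_simplex n) (selberg_integrand q n r s m) [1..<Suc n] =
    infsum (\<lambda>y. selberg_integrand q n r s m (lattice_point q {1..n} y) * lattice_weight q {1..n} y)
      {y \<in> {1..n} \<rightarrow>\<^sub>E UNIV. \<forall>(i, j)\<in>index_pairs n. y j \<le> y i}"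
    by (rule multi_q_integral_selberg_integrand[OF q])
  also have "\<dots> = infsum (\<lambda>y. ?c * (chain_product q n r s m y * lattice_weight q {1..n} y))
      ({1..n} \<rightarrow>\<^sub>E UNIV)"
  proof (rule infsum_cong_neutral)
    fix y :: "nat \<Rightarrow> nat"
    assume "y \<in> ({1..n} \<rightarrow>\<^sub>E UNIV) - {y \<in> {1..n} \<rightarrow>\<^sub>E UNIV. \<forall>(i, j)\<in>index_pairs n. y j \<le> y i}"
    then obtain i j where "(i, j) \<in> index_pairs n" "y i < y j"
      by (auto simp: not_le)
    then show "?c * (chain_product q n r s m y * lattice_weight q {1..n} y) = 0"
      using chain_product_eq_0[OF m] by simp
  next
    fix y :: "nat \<Rightarrow> nat"
    assume "y \<in> {y \<in> {1..n} \<rightarrow>\<^sub>E UNIV. \<forall>(i, j)\<in>index_pairs n. y j \<le> y i} \<inter> ({1..n} \<rightarrow>\<^sub>E UNIV)"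
    then have "y j \<le> y i" if "(i, j) \<in> index_pairs n" for i j
      using that by blast
    from selberg_integrand_lattice[OF q m this]
    show "selberg_integrand q n r s m (lattice_point q {1..n} y) * lattice_weight q {1..n} y =
      ?c * (chain_product q n r s m y * lattice_weight q {1..n} y)"
      by (simp add: mult_ac)
  qed auto
  also have "\<dots> = ?c * multi_q_integral q
      (order_polytope (selberg_carrier n r s m) (selberg_le n r s m)) (\<lambda>_. 1) (selberg_word n r s m)"
    unfolding multi_q_integral_selberg[OF q m] by (rule infsum_cmult_right')
  finally show ?thesis
    unfolding selberg_integrand_def[abs_def] .
qed

end
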